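(* Let $p$ be an odd prime, $q=p^e$, and let $l\ge3$ be coprime to $p$ with $(p,l)$ hyperbolic, i.e. $1/p+1/l<1/2$. Let $\xi_\lambda$ be a primitive $2l$-th root of unity in $GF(q)$ or $GF(q^2)$ and $\omega_\lambda=\xi_\lambda+\xi_\lambda^{-1}$. Consider the regular map of type $(p,l)$ given by the generating triple $(X,Y,Z)$ of matrices determined by $\xi_\lambda$ described in the context, where $G=\langle X,Y,Z\rangle$ is isomorphic to $PSL(2,q)$ or $PGL(2,q)$. Then the map is self-Petrie-dual if and only if there is an integer $j$ with $2j=e$ such that, with $r=p^j$, $\omega_\lambda^2=-\omega_\lambda^{2r}$.
   Context: A regular map of type $(k,l)$ (vertex degree $k$, face length $l$) is identified with a group $G$ generated by three involutions $X,Y,Z$ such that $XY$, $YZ$, $ZX$ have orders exactly $2,k,l$ respectively. The map is self-Petrie-dual if $G$ has an (involutory) automorphism fixing $Y$ and $Z$ and interchanging $X$ and $XY$. Matrices are regarded up to nonzero scalar multiples, i.e. as elements of $PGL(2,K)$ with $K$ an algebraic closure of $GF(p)$. For type $(p,l)$ with $l$ coprime to $p$ the generating triple is, with $\alpha^2=-1$, $$X=\alpha\begin{pmatrix}0&\omega_\lambda^{-1}\\ \omega_\lambda&0\end{pmatrix},\quad Y=-\alpha\begin{pmatrix}1&0\\0&-1\end{pmatrix},\quad Z=\alpha\begin{pmatrix}1&1\\0&-1\end{pmatrix}.$$ *)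

theory Defs
  imports
    "HOL-Analysis.Determinants"
    "HOL-Algebra.Algebraic_Closure_Type"
    "HOL-Algebra.Elementary_Groups"
    "HOL-Number_Theory.Residues"
begin

hide_const (open) Divisibility.prime

section \<open>Regular maps\<close>

text \<open>A regular map of type \<open>(k, l)\<close>, with vertex degree \<open>k\<close> and face length \<open>l\<close>, is identified with
  its automorphism group and three generating involutions.\<close>

definition regular_map :: "('g, 'b) monoid_scheme \<Rightarrow> 'g \<Rightarrow> 'g \<Rightarrow> 'g \<Rightarrow> nat \<Rightarrow> nat \<Rightarrow> bool" where
  "regular_map G x y z k l \<longleftrightarrow>
     group G \<and> {x, y, z} \<subseteq> carrier G \<and> generate G {x, y, z} = carrier G \<and>
     group.ord G x = 2 \<and> group.ord G y = 2 \<and> group.ord G z = 2 \<and>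
     group.ord G (x \<otimes>\<^bsub>G\<^esub> y) = 2 \<and> group.ord G (y \<otimes>\<^bsub>G\<^esub> z) = k \<and> group.ord G (z \<otimes>\<^bsub>G\<^esub> x) = l"

definition self_petrie_dual :: "('g, 'b) monoid_scheme \<Rightarrow> 'g \<Rightarrow> 'g \<Rightarrow> 'g \<Rightarrow> bool" where
  "self_petrie_dual G x y z \<longleftrightarrow>
     (\<exists>\<sigma> \<in> iso G G. (\<forall>g \<in> carrier G. \<sigma> (\<sigma> g) = g) \<and>
        \<sigma> y = y \<and> \<sigma> z = z \<and> \<sigma> x = x \<otimes>\<^bsub>G\<^esub> y \<and> \<sigma> (x \<otimes>\<^bsub>G\<^esub> y) = x)"

section \<open>Linear groups\<close>

text \<open>The subfield with \<open>q\<close> elements of an algebraically closed field whose characteristic divides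
  the prime power \<open>q\<close>.\<close>
definition GF :: "nat \<Rightarrow> 'a::field set" where
  "GF q = {x. x ^ q = x}"

text \<open>Below, \<open>F\<close> is the underlying set of a subfield of the type \<open>'a\<close>.\<close>

definition GL2 :: "'a::field set \<Rightarrow> ('a^2^2) monoid" where
  "GL2 F = \<lparr>carrier = {A. (\<forall>i j. A $ i $ j \<in> F) \<and> det A \<noteq> 0}, mult = (**), one = mat 1\<rparr>"

definition SL2 :: "'a::field set \<Rightarrow> ('a^2^2) monoid" where
  "SL2 F = (GL2 F)\<lparr>carrier := {A \<in> carrier (GL2 F). det A = 1}\<rparr>"

definition scalars2 :: "'a::field set \<Rightarrow> ('a^2^2) set" where
  "scalars2 F = {mat c |c. c \<in> F \<and> c \<noteq> 0}"

definition PGL2 :: "'a::field set \<Rightarrow> ('a^2^2) set monoid" where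
  "PGL2 F = GL2 F Mod scalars2 F"

definition PSL2 :: "'a::field set \<Rightarrow> ('a^2^2) set monoid" where
  "PSL2 F = SL2 F Mod (scalars2 F \<inter> carrier (SL2 F))"

text \<open>The matrix \<open>A\<close> up to nonzero scalar multiples, as an element of \<open>PGL(2, K)\<close>.\<close>
definition proj_class :: "'a::field^2^2 \<Rightarrow> ('a^2^2) set" where
  "proj_class A = scalars2 UNIV #>\<^bsub>GL2 UNIV\<^esub> A"

section \<open>The generating triple\<close>

definition gen_X :: "'a::field \<Rightarrow> 'a \<Rightarrow> ('a^2^2) set" where
  "gen_X \<alpha> \<omega> = proj_class (mat \<alpha> ** vector [vector [0, inverse \<omega>], vector [\<omega>, 0]])"

definition gen_Y :: "'a::field \<Rightarrow> ('a^2^2) set" where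
  "gen_Y \<alpha> = proj_class (mat (- \<alpha>) ** vector [vector [1, 0], vector [0, - 1]])"

definition gen_Z :: "'a::field \<Rightarrow> ('a^2^2) set" where
  "gen_Z \<alpha> = proj_class (mat \<alpha> ** vector [vector [1, 1], vector [0, - 1]])"

definition map_group :: "'a::field \<Rightarrow> 'a \<Rightarrow> ('a^2^2) set monoid" where
  "map_group \<alpha> \<omega> = subgroup_generated (PGL2 UNIV) {gen_X \<alpha> \<omega>, gen_Y \<alpha>, gen_Z \<alpha>}"

definition primitive_root_of_unity :: "nat \<Rightarrow> 'a::field \<Rightarrow> bool" where
  "primitive_root_of_unity n x \<longleftrightarrow> n > 0 \<and> x ^ n = 1 \<and> (\<forall>m. 0 < m \<and> m < n \<longrightarrow> x ^ m \<noteq> 1)"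

section \<open>The triple gives a regular map of type \<open>(p, l)\<close>\<close>

text \<open>This section shows that \<open>map_group\<close> with the generating triple satisfies \<open>regular_map\<close>; hence
  no statement about this map needs that property as an assumption.\<close>

lemmas mat2_simps = vec_eq_iff forall_2 sum_2 matrix_matrix_mult_def mat_def det_2 vector_2

lemma group_GL2: "group (GL2 (UNIV :: 'a::field set))"
proof (rule groupI)
  fix A :: "'a^2^2" assume "A \<in> carrier (GL2 UNIV)"
  then have "invertible A"
    by (simp add: GL2_def invertible_det_nz)
  then obtain B where B: "A ** B = mat 1" "B ** A = mat 1"
    unfolding invertible_def by blast
  then have "det B * det A = 1"
    by (metis det_I det_mul)
  then have "det B \<noteq> 0" by auto
  with B show "\<exists>B\<in>carrier (GL2 UNIV). B \<otimes>\<^bsub>GL2 UNIV\<^esub> A = \<one>\<^bsub>GL2 UNIV\<^esub>"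
    by (auto simp: GL2_def)
qed (auto simp: GL2_def det_mul matrix_mul_assoc)

lemma mat_mult_mat: "mat c ** mat d = (mat (c * d) :: 'a::field^2^2)"
  by (simp add: mat2_simps)

lemma mat_comm: "mat c ** A = A ** mat c" for A :: "'a::field^2^2"
  by (simp add: mat2_simps mult.commute)

lemma mat_nonzero_carrier: "c \<noteq> 0 \<Longrightarrow> (mat c :: 'a::field^2^2) \<in> carrier (GL2 UNIV)"
  by (simp add: GL2_def mat2_simps)

lemma normal_scalars2: "scalars2 UNIV \<lhd> GL2 (UNIV :: 'a::field set)"
proof -
  interpret group "GL2 (UNIV :: 'a set)" by (rule group_GL2)
  have inv: "inv\<^bsub>GL2 UNIV\<^esub> (mat c) = (mat (inverse c) :: 'a^2^2)" if "c \<noteq> 0" for c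
    using that by (intro inv_equality) (auto simp: mat_nonzero_carrier mat_mult_mat GL2_def mat2_simps)
  have "subgroup (scalars2 UNIV) (GL2 (UNIV :: 'a set))"
  proof
    show "scalars2 UNIV \<subseteq> carrier (GL2 (UNIV :: 'a set))"
      by (auto simp: scalars2_def mat_nonzero_carrier)
    show "A \<otimes>\<^bsub>GL2 UNIV\<^esub> B \<in> scalars2 UNIV" if "A \<in> scalars2 UNIV" "B \<in> scalars2 UNIV" for A B :: "'a^2^2"
      using that by (fastforce simp: scalars2_def GL2_def mat_mult_mat)
    show "\<one>\<^bsub>GL2 UNIV\<^esub> \<in> scalars2 (UNIV :: 'a set)"
      by (auto simp: scalars2_def GL2_def)
    show "inv\<^bsub>GL2 UNIV\<^esub> A \<in> scalars2 UNIV" if "A \<in> scalars2 UNIV" for A :: "'a^2^2"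
      using that inv by (fastforce simp: scalars2_def)
  qed
  moreover have "A \<otimes>\<^bsub>GL2 UNIV\<^esub> h \<otimes>\<^bsub>GL2 UNIV\<^esub> inv\<^bsub>GL2 UNIV\<^esub> A \<in> scalars2 UNIV"
    if A: "A \<in> carrier (GL2 UNIV)" and h: "h \<in> scalars2 UNIV" for A h :: "'a^2^2"
  proof -
    have "h \<in> carrier (GL2 UNIV)"
      using h by (auto simp: scalars2_def mat_nonzero_carrier)
    moreover have "A \<otimes>\<^bsub>GL2 UNIV\<^esub> h = h \<otimes>\<^bsub>GL2 UNIV\<^esub> A"
      using h by (auto simp: scalars2_def GL2_def mat_comm)
    ultimately show ?thesis
      using A h by (simp add: m_assoc)
  qed
  ultimately show ?thesis
    by (simp add: normal_inv_iff)
qed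

lemma group_PGL2: "group (PGL2 (UNIV :: 'a::field set))"
  unfolding PGL2_def by (rule normal.factorgroup_is_group[OF normal_scalars2])

lemma proj_class_carrier:
  fixes A :: "'a::field^2^2"
  assumes "det A \<noteq> 0"
  shows "proj_class A \<in> carrier (PGL2 UNIV)"
  using assms unfolding PGL2_def proj_class_def FactGroup_def RCOSETS_def
  by (auto simp: GL2_def)

lemma proj_class_mult:
  fixes A B :: "'a::field^2^2"
  assumes "det A \<noteq> 0" "det B \<noteq> 0"
  shows "proj_class A \<otimes>\<^bsub>PGL2 UNIV\<^esub> proj_class B = proj_class (A ** B)"
  using normal.rcos_sum[OF normal_scalars2, of A B] assms
  by (simp add: PGL2_def proj_class_def FactGroup_def GL2_def)

lemma proj_class_eq_one:
  fixes A :: "'a::field^2^2"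
  assumes "det A \<noteq> 0"
  shows "proj_class A = \<one>\<^bsub>PGL2 UNIV\<^esub> \<longleftrightarrow> A $ 1 $ 2 = 0 \<and> A $ 2 $ 1 = 0 \<and> A $ 1 $ 1 = A $ 2 $ 2"
proof -
  interpret normal "scalars2 UNIV" "GL2 (UNIV :: 'a set)" by (rule normal_scalars2)
  have A: "A \<in> carrier (GL2 UNIV)" using assms by (simp add: GL2_def)
  have "proj_class A = \<one>\<^bsub>PGL2 UNIV\<^esub> \<longleftrightarrow> A \<in> scalars2 UNIV"
    unfolding PGL2_def proj_class_def FactGroup_def
    using A by (metis coset_join1 coset_join2 monoid.select_convs(2) subgroup_axioms subset)
  also have "\<dots> \<longleftrightarrow> A $ 1 $ 2 = 0 \<and> A $ 2 $ 1 = 0 \<and> A $ 1 $ 1 = A $ 2 $ 2"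
    using assms by (auto simp: scalars2_def mat2_simps)
  finally show ?thesis .
qed

lemma det_power: "det A \<noteq> 0 \<Longrightarrow> det ((((**) A) ^^ n) (mat 1)) \<noteq> 0"
  for A :: "'a::field^2^2"
  by (induction n) (auto simp: det_mul)

lemma proj_class_pow:
  fixes A :: "'a::field^2^2"
  assumes "det A \<noteq> 0"
  shows "proj_class A [^]\<^bsub>PGL2 UNIV\<^esub> (n::nat) = proj_class ((((**) A) ^^ n) (mat 1))"
proof (induction n)
  case 0
  show ?case
    using proj_class_eq_one[of "mat 1 :: 'a^2^2"] by (simp add: mat2_simps)
next
  case (Suc n)
  interpret group "PGL2 (UNIV :: 'a set)" by (rule group_PGL2)
  show ?case
    using Suc nat_pow_Suc2[OF proj_class_carrier[OF assms], of n]
    by (simp add: proj_class_mult assms det_power del: nat_pow_Suc)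
qed

lemma ord_map_group:
  fixes A :: "'a::field^2^2"
  assumes "det A \<noteq> 0" and "proj_class A \<in> carrier (map_group \<alpha> \<omega>)"
    and "\<And>n. (let B = (((**) A) ^^ n) (mat 1) in
                 B $ 1 $ 2 = 0 \<and> B $ 2 $ 1 = 0 \<and> B $ 1 $ 1 = B $ 2 $ 2) \<longleftrightarrow> d dvd n"
  shows "group.ord (map_group \<alpha> \<omega>) (proj_class A) = d"
proof -
  interpret P: group "PGL2 (UNIV :: 'a set)" by (rule group_PGL2)
  interpret G: group "map_group \<alpha> \<omega>" unfolding map_group_def by simp
  have "proj_class A [^]\<^bsub>map_group \<alpha> \<omega>\<^esub> n = proj_class A [^]\<^bsub>PGL2 UNIV\<^esub> n" for n :: nat
    by (simp add: nat_pow_def map_group_def)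
  then show ?thesis
    using assms(3)
    by (subst G.ord_unique[OF assms(2)])
       (simp add: map_group_def proj_class_pow assms(1) proj_class_eq_one det_power Let_def)
qed

lemma ord_two:
  fixes A :: "'a::field^2^2"
  assumes "det A \<noteq> 0" and "proj_class A \<in> carrier (map_group \<alpha> \<omega>)"
    and A2: "A ** A = mat c" and ns: "\<not> (A $ 1 $ 2 = 0 \<and> A $ 2 $ 1 = 0 \<and> A $ 1 $ 1 = A $ 2 $ 2)"
  shows "group.ord (map_group \<alpha> \<omega>) (proj_class A) = 2"
proof -
  have c: "c \<noteq> 0"
    using A2 assms(1) det_mul[of A A] by (auto simp: mat2_simps)
  have even: "(((**) A) ^^ (2 * k)) (mat 1) = mat (c ^ k)" for k
    by (induction k) (auto simp: matrix_mul_assoc A2 mat_mult_mat)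
  have odd: "(((**) A) ^^ (Suc (2 * k))) (mat 1) = A ** mat (c ^ k)" for k
    using even[of k] by simp
  show ?thesis
  proof (rule ord_map_group[OF assms(1,2)])
    fix n
    show "(let B = (((**) A) ^^ n) (mat 1) in
            B $ 1 $ 2 = 0 \<and> B $ 2 $ 1 = 0 \<and> B $ 1 $ 1 = B $ 2 $ 2) \<longleftrightarrow> 2 dvd n"
    proof (cases "even n")
      case True
      then obtain k where "n = 2 * k" by blast
      then show ?thesis unfolding \<open>n = 2 * k\<close> even by (simp add: mat2_simps)
    next
      case False
      then obtain k where k: "n = Suc (2 * k)" by (metis Suc_eq_plus1 oddE)
      show ?thesis unfolding k odd using ns c by (auto simp: mat2_simps)
    qed
  qed
qed

lemma regular_map_map_group:
  fixes \<alpha> \<xi> \<omega> :: "'f::finite_field alg_closure"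
  assumes "prime p" and "odd p" and card: "CARD('f) = p" and "l \<ge> 3"
    and \<alpha>: "\<alpha>\<^sup>2 = - 1"
    and prim: "primitive_root_of_unity (2 * l) \<xi>" and \<omega>: "\<omega> = \<xi> + inverse \<xi>"
  shows "regular_map (map_group \<alpha> \<omega>) (gen_X \<alpha> \<omega>) (gen_Y \<alpha>) (gen_Z \<alpha>) p l"
proof -
  have CHAR: "CHAR('f alg_closure) = p"
    using CHAR_dvd_CARD[where 'a='f] card \<open>prime p\<close>
    by (metis CHAR_alg_closure CHAR_not_1 One_nat_def prime_nat_iff)
  have two: "(2 :: 'f alg_closure) \<noteq> 0"
  proof
    assume "(2 :: 'f alg_closure) = 0"
    then have "p dvd 2"
      using CHAR of_nat_eq_0_iff_char_dvd[of 2, where 'a="'f alg_closure"] by simp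
    then show False
      using \<open>odd p\<close> \<open>prime p\<close> by (metis primes_dvd_imp_eq two_is_prime_nat dvd_refl)
  qed
  have \<alpha>0: "\<alpha> \<noteq> 0" using \<alpha> by auto
  have \<alpha>\<alpha>: "\<alpha> * \<alpha> = -1" using \<alpha> by (simp add: power2_eq_square)
  have \<alpha>c: "\<alpha> * (\<alpha> * c) = - c" for c
    by (simp add: \<alpha>\<alpha> flip: mult.assoc)
  have \<xi>0: "\<xi> \<noteq> 0"
    using prim \<open>l \<ge> 3\<close> by (auto simp: primitive_root_of_unity_def power_0_left)
  have \<xi>_dvd: "\<xi> ^ n = 1 \<longleftrightarrow> 2 * l dvd n" for n
  proof
    assume n: "\<xi> ^ n = 1"
    have "\<xi> ^ n = (\<xi> ^ (2 * l)) ^ (n div (2 * l)) * \<xi> ^ (n mod (2 * l))"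
      by (metis mult_div_mod_eq power_add power_mult)
    then have "\<xi> ^ (n mod (2 * l)) = 1"
      using n prim by (simp add: primitive_root_of_unity_def)
    then have "n mod (2 * l) = 0"
      using prim unfolding primitive_root_of_unity_def by (metis mod_less_divisor neq0_conv)
    then show "2 * l dvd n" by auto
  next
    assume "2 * l dvd n"
    then show "\<xi> ^ n = 1"
      using prim by (auto simp: primitive_root_of_unity_def power_mult)
  qed
  have \<xi>2: "\<xi> ^ 2 \<noteq> 1" and \<xi>4: "\<xi> ^ 4 \<noteq> 1"
    using \<open>l \<ge> 3\<close> by (auto simp: \<xi>_dvd dest!: dvd_imp_le)
  have \<omega>0: "\<omega> \<noteq> 0"
  proof
    assume "\<omega> = 0"
    then have "\<xi> * (\<xi> + inverse \<xi>) = 0" by (simp add: \<omega>)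
    then have "\<xi> ^ 2 + 1 = 0" using \<xi>0 by (simp add: distrib_left power2_eq_square)
    then have "\<xi> ^ 2 = -1" by (simp add: eq_neg_iff_add_eq_0)
    moreover have "\<xi> ^ 4 = (\<xi> ^ 2) ^ 2" by (simp flip: power_mult)
    ultimately have "\<xi> ^ 4 = 1" by simp
    with \<xi>4 show False by simp
  qed

  define MX where "MX = mat \<alpha> ** (vector [vector [0, inverse \<omega>], vector [\<omega>, 0]] :: 'f alg_closure^2^2)"
  define MY where "MY = mat (- \<alpha>) ** (vector [vector [1, 0], vector [0, - 1]] :: 'f alg_closure^2^2)"
  define MZ where "MZ = mat \<alpha> ** (vector [vector [1, 1], vector [0, - 1]] :: 'f alg_closure^2^2)"
  have MX: "MX $ 1 $ 1 = 0" "MX $ 1 $ 2 = \<alpha> * inverse \<omega>" "MX $ 2 $ 1 = \<alpha> * \<omega>" "MX $ 2 $ 2 = 0"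
    by (simp_all add: MX_def mat2_simps)
  have MY: "MY $ 1 $ 1 = - \<alpha>" "MY $ 1 $ 2 = 0" "MY $ 2 $ 1 = 0" "MY $ 2 $ 2 = \<alpha>"
    by (simp_all add: MY_def mat2_simps)
  have MZ: "MZ $ 1 $ 1 = \<alpha>" "MZ $ 1 $ 2 = \<alpha>" "MZ $ 2 $ 1 = 0" "MZ $ 2 $ 2 = - \<alpha>"
    by (simp_all add: MZ_def mat2_simps)
  have det: "det MX \<noteq> 0" "det MY \<noteq> 0" "det MZ \<noteq> 0"
    using \<alpha>0 \<omega>0 by (simp_all add: det_2 MX MY MZ)
  have XYZ: "gen_X \<alpha> \<omega> = proj_class MX" "gen_Y \<alpha> = proj_class MY" "gen_Z \<alpha> = proj_class MZ"
    by (simp_all add: gen_X_def gen_Y_def gen_Z_def MX_def MY_def MZ_def)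

  interpret P: group "PGL2 (UNIV :: 'f alg_closure set)" by (rule group_PGL2)
  interpret G: group "map_group \<alpha> \<omega>" unfolding map_group_def by simp
  let ?S = "{proj_class MX, proj_class MY, proj_class MZ}"
  have sub: "?S \<subseteq> carrier (PGL2 UNIV)"
    using det by (simp add: proj_class_carrier)
  then have subG: "?S \<subseteq> carrier (map_group \<alpha> \<omega>)"
    unfolding map_group_def XYZ by (rule P.subgroup_generated_subset_carrier_subset)
  have gen: "generate (map_group \<alpha> \<omega>) ?S = carrier (map_group \<alpha> \<omega>)"
  proof -
    have "subgroup (generate (PGL2 UNIV) ?S) (PGL2 UNIV)"
      by (rule P.generate_is_subgroup[OF sub])
    then show ?thesis
      using P.generate_consistent[of ?S "generate (PGL2 UNIV) ?S"] sub
      by (simp add: map_group_def subgroup_generated_def XYZ Int_absorb1 subset_iff generate.incl)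
  qed
  have mult: "proj_class A \<otimes>\<^bsub>map_group \<alpha> \<omega>\<^esub> proj_class B = proj_class (A ** B)"
    if "det A \<noteq> 0" "det B \<noteq> 0" for A B :: "'f alg_closure^2^2"
    using that by (simp add: map_group_def proj_class_mult)
  have mem: "proj_class (A ** B) \<in> carrier (map_group \<alpha> \<omega>)"
    if "det A \<noteq> 0" "det B \<noteq> 0" "proj_class A \<in> ?S" "proj_class B \<in> ?S" for A B
    unfolding mult[OF that(1,2), symmetric] by (rule G.m_closed) (use that subG in blast)+

  have "group.ord (map_group \<alpha> \<omega>) (proj_class MX) = 2"
    using det subG \<alpha>0 \<omega>0
    by (intro ord_two[where c = "-1"]) (auto simp: MX mat2_simps \<alpha>\<alpha> \<alpha>c field_simps)
  moreover have "group.ord (map_group \<alpha> \<omega>) (proj_class MY) = 2"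
    using det subG \<alpha>0 two
    by (intro ord_two[where c = "-1"]) (auto simp: MY mat2_simps \<alpha>\<alpha>)
  moreover have "group.ord (map_group \<alpha> \<omega>) (proj_class MZ) = 2"
    using det subG \<alpha>0
    by (intro ord_two[where c = "-1"]) (auto simp: MZ mat2_simps \<alpha>\<alpha>)
  moreover have "group.ord (map_group \<alpha> \<omega>) (proj_class (MX ** MY)) = 2"
    using det mem \<alpha>0 \<omega>0
    by (intro ord_two[where c = "-1"]) (auto simp: det_mul MX MY mat2_simps \<alpha>\<alpha> \<alpha>c field_simps)
  moreover have "group.ord (map_group \<alpha> \<omega>) (proj_class (MY ** MZ)) = p"
  proof (rule ord_map_group)
    fix n
    have YZ: "MY ** MZ = vector [vector [1, 1], vector [0, 1]]"
      by (simp add: mat2_simps MY MZ \<alpha>\<alpha>)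
    have "(((**) (MY ** MZ)) ^^ n) (mat 1) = vector [vector [1, of_nat n], vector [0, 1]]"
      unfolding YZ by (induction n) (simp_all add: mat2_simps)
    then show "(let B = (((**) (MY ** MZ)) ^^ n) (mat 1) in
            B $ 1 $ 2 = 0 \<and> B $ 2 $ 1 = 0 \<and> B $ 1 $ 1 = B $ 2 $ 2) \<longleftrightarrow> p dvd n"
      using CHAR by (simp add: vector_2 of_nat_eq_0_iff_char_dvd)
  qed (use det mem in \<open>auto simp: det_mul\<close>)
  moreover have "group.ord (map_group \<alpha> \<omega>) (proj_class (MZ ** MX)) = l"
  proof (rule ord_map_group)
    fix n
    define \<eta> where "\<eta> = inverse \<xi>"
    have \<xi>\<eta>: "\<xi> * \<eta> = 1" using \<xi>0 by (simp add: \<eta>_def)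
    have ne: "\<xi> - \<eta> \<noteq> 0"
      using \<xi>2 \<xi>\<eta> by (auto simp: power2_eq_square)
    define s where "s n = \<xi> ^ n - \<eta> ^ n" for n :: nat
    have ss: "s (Suc (Suc n)) = \<omega> * s (Suc n) - s n" for n
    proof -
      have "\<omega> * s (Suc n) = s (Suc (Suc n)) + (\<xi> * \<eta>) * s n"
        by (simp add: s_def \<omega> \<eta>_def[symmetric] algebra_simps)
      then show ?thesis by (simp add: \<xi>\<eta>)
    qed
    define N where "N = MZ ** MX"
    have N: "N $ 1 $ 1 = - \<omega>" "N $ 1 $ 2 = - inverse \<omega>" "N $ 2 $ 1 = \<omega>" "N $ 2 $ 2 = 0"
      by (simp_all add: N_def matrix_matrix_mult_def sum_2 MX MZ \<alpha>c)
    define B where "B n = (((**) N) ^^ n) (mat 1)" for n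
    have B: "(\<xi> - \<eta>) * (B n $ 1 $ 1) = (-1) ^ n * s (Suc n) \<and>
             (\<xi> - \<eta>) * (B n $ 2 $ 1) = - ((-1) ^ n * \<omega> * s n) \<and>
             (\<xi> - \<eta>) * (B n $ 1 $ 2) * \<omega> = (-1) ^ n * s n \<and>
             (\<xi> - \<eta>) * (B n $ 2 $ 2) = (-1) ^ n * (s (Suc n) - \<omega> * s n)" for n
    proof (induction n)
      case 0
      show ?case by (simp add: B_def mat_def s_def)
    next
      case (Suc n)
      have BS: "B (Suc n) $ 1 $ 1 = - \<omega> * B n $ 1 $ 1 - inverse \<omega> * B n $ 2 $ 1"
        "B (Suc n) $ 1 $ 2 = - \<omega> * B n $ 1 $ 2 - inverse \<omega> * B n $ 2 $ 2"
        "B (Suc n) $ 2 $ 1 = \<omega> * B n $ 1 $ 1" "B (Suc n) $ 2 $ 2 = \<omega> * B n $ 1 $ 2"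
        by (simp_all add: B_def matrix_matrix_mult_def sum_2 N)
      have "(\<xi> - \<eta>) * (B (Suc n) $ 1 $ 1) = - \<omega> * ((\<xi> - \<eta>) * B n $ 1 $ 1) - inverse \<omega> * ((\<xi> - \<eta>) * B n $ 2 $ 1)"
        by (simp add: BS algebra_simps)
      also have "\<dots> = (-1) ^ Suc n * s (Suc (Suc n))"
        using Suc \<omega>0 by (simp add: ss field_simps)
      finally have 1: "(\<xi> - \<eta>) * (B (Suc n) $ 1 $ 1) = (-1) ^ Suc n * s (Suc (Suc n))" .
      have "(\<xi> - \<eta>) * (B (Suc n) $ 2 $ 1) = \<omega> * ((\<xi> - \<eta>) * B n $ 1 $ 1)"
        by (simp add: BS algebra_simps)
      also have "\<dots> = - ((-1) ^ Suc n * \<omega> * s (Suc n))"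
        using Suc by simp
      finally have 2: "(\<xi> - \<eta>) * (B (Suc n) $ 2 $ 1) = - ((-1) ^ Suc n * \<omega> * s (Suc n))" .
      have "(\<xi> - \<eta>) * (B (Suc n) $ 1 $ 2) * \<omega> = - \<omega> * ((\<xi> - \<eta>) * B n $ 1 $ 2 * \<omega>) - (\<xi> - \<eta>) * B n $ 2 $ 2"
        using \<omega>0 by (simp add: BS field_simps)
      also have "\<dots> = (-1) ^ Suc n * s (Suc n)"
        using Suc by (simp add: algebra_simps)
      finally have 3: "(\<xi> - \<eta>) * (B (Suc n) $ 1 $ 2) * \<omega> = (-1) ^ Suc n * s (Suc n)" .
      have "(\<xi> - \<eta>) * (B (Suc n) $ 2 $ 2) = (\<xi> - \<eta>) * B n $ 1 $ 2 * \<omega>"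
        by (simp add: BS algebra_simps)
      also have "\<dots> = (-1) ^ Suc n * (s (Suc (Suc n)) - \<omega> * s (Suc n))"
        using Suc by (simp add: ss)
      finally have 4: "(\<xi> - \<eta>) * (B (Suc n) $ 2 $ 2) = (-1) ^ Suc n * (s (Suc (Suc n)) - \<omega> * s (Suc n))" .
      from 1 2 3 4 show ?case by blast
    qed
    have "(B n $ 1 $ 2 = 0 \<and> B n $ 2 $ 1 = 0 \<and> B n $ 1 $ 1 = B n $ 2 $ 2) \<longleftrightarrow> s n = 0"
    proof
      assume "B n $ 1 $ 2 = 0 \<and> B n $ 2 $ 1 = 0 \<and> B n $ 1 $ 1 = B n $ 2 $ 2"
      then show "s n = 0" using B[of n] by simp
    next
      assume "s n = 0"
      then have "(\<xi> - \<eta>) * (B n $ 1 $ 1) = (\<xi> - \<eta>) * (B n $ 2 $ 2)"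
        "(\<xi> - \<eta>) * (B n $ 2 $ 1) = 0" "(\<xi> - \<eta>) * (B n $ 1 $ 2) * \<omega> = 0"
        using B[of n] by simp_all
      then show "B n $ 1 $ 2 = 0 \<and> B n $ 2 $ 1 = 0 \<and> B n $ 1 $ 1 = B n $ 2 $ 2"
        using ne \<omega>0 by simp
    qed
    also have "\<dots> \<longleftrightarrow> \<xi> ^ (2 * n) = 1"
    proof -
      have "\<xi> ^ n * \<eta> ^ n = 1" by (simp add: \<xi>\<eta> flip: power_mult_distrib)
      then have "\<xi> ^ n * s n = \<xi> ^ (2 * n) - 1"
        by (simp add: s_def right_diff_distrib mult_2 power_add)
      then show ?thesis using \<xi>0 by (metis eq_iff_diff_eq_0 mult_eq_0_iff power_not_zero)
    qed
    also have "\<dots> \<longleftrightarrow> l dvd n" by (simp add: \<xi>_dvd)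
    finally show "(let B = (((**) (MZ ** MX)) ^^ n) (mat 1) in
            B $ 1 $ 2 = 0 \<and> B $ 2 $ 1 = 0 \<and> B $ 1 $ 1 = B $ 2 $ 2) \<longleftrightarrow> l dvd n"
      by (simp add: B_def N_def Let_def)
  qed (use det mem in \<open>auto simp: det_mul\<close>)
  ultimately show ?thesis
    unfolding regular_map_def XYZ using gen subG det by (simp add: mult)
qed

end

theory Submission
  imports Defs
begin

text \<open>
  Put \<open>w = \<omega>\<^sup>2\<close>. Up to scalars \<open>X\<close> has the rows \<open>(0, 1), (w, 0)\<close>, the product \<open>XY\<close> has the rows
  \<open>(0, 1), (-w, 0)\<close>, and \<open>u = YZ\<close> is the translation by \<open>1\<close>. If \<open>w\<^sup>r = - w\<close> with \<open>r\<close> a power of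
  \<open>p\<close>, the entrywise Frobenius map \<open>x \<mapsto> x\<^sup>r\<close> is the required automorphism.

  Conversely, neither Dickson's classification nor the structure of \<open>Aut (PSL(2, q))\<close> is needed.
  An automorphism \<open>\<sigma>\<close> fixing \<open>Y\<close> and \<open>Z\<close> fixes \<open>u\<close>, so it acts on the centraliser of \<open>u\<close>, which is
  the group of translations by the elements of an additive group \<open>B\<close>. Scalings by squares normalise
  these translations, and every element of a field is a difference of two squares, so the action is a
  field automorphism \<open>\<theta>\<close> as soon as \<open>B\<close> is a field containing \<open>w\<close> and all scalings by its squares
  lie in the group; a relation between \<open>X\<close>, \<open>Y\<close> and the translations then shows \<open>\<theta> w = - w\<close>.
  The same argument, applied to the isomorphism with \<open>PSL(2, q)\<close> or \<open>PGL(2, q)\<close> after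
  conjugating it so that it fixes \<open>u\<close> and \<open>Y\<close>, identifies \<open>B\<close> as a field with \<open>q\<close> elements.
  Finally \<open>\<theta>\<close> is an involution, hence \<open>q\<close> is the square of the order \<open>r\<close> of its fixed field,
  and \<open>(w\<^sup>r)\<^sup>2 = w\<^sup>2\<close> while \<open>w\<^sup>r \<noteq> w\<close>.
\<close>

section \<open>Elements of \<open>PGL(2, K)\<close>\<close>

interpretation PGL: group "PGL2 (UNIV :: 'a::field set)"
  by (rule group_PGL2)

abbreviation pgl_mult :: "('a::field^2^2) set \<Rightarrow> ('a^2^2) set \<Rightarrow> ('a^2^2) set" (infixl "\<star>" 70) where
  "x \<star> y \<equiv> x \<otimes>\<^bsub>PGL2 UNIV\<^esub> y"

definition mob :: "'a::field \<Rightarrow> 'a \<Rightarrow> 'a \<Rightarrow> 'a \<Rightarrow> ('a^2^2) set" where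
  "mob a b c d = proj_class (vector [vector [a, b], vector [c, d]])"

text \<open>As Moebius transformations, \<open>uni b\<close> is z -> z + b, \<open>dia s\<close> is
  z -> s z and \<open>anti s\<close> is z -> 1 / (s z): the translations, the scalings, and the
  elements swapping 0 and infinity.\<close>

abbreviation uni :: "'a::field \<Rightarrow> ('a^2^2) set" where "uni b \<equiv> mob 1 b 0 1"

abbreviation dia :: "'a::field \<Rightarrow> ('a^2^2) set" where "dia s \<equiv> mob s 0 0 1"

abbreviation anti :: "'a::field \<Rightarrow> ('a^2^2) set" where "anti s \<equiv> mob 0 1 s 0"

lemma proj_class_altdef:
  fixes A :: "'a::field^2^2"
  shows "proj_class A = {mat k ** A | k. k \<noteq> 0}"
  unfolding proj_class_def r_coset_def scalars2_def by (auto simp: GL2_def)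

lemma proj_class_eq_iff:
  fixes A B :: "'a::field^2^2"
  shows "proj_class A = proj_class B \<longleftrightarrow> (\<exists>k. k \<noteq> 0 \<and> A = mat k ** B)"
proof
  assume "proj_class A = proj_class B"
  moreover have "A \<in> proj_class A"
    unfolding proj_class_altdef by (auto intro!: exI[of _ 1])
  ultimately show "\<exists>k. k \<noteq> 0 \<and> A = mat k ** B"
    unfolding proj_class_altdef by auto
next
  assume "\<exists>k. k \<noteq> 0 \<and> A = mat k ** B"
  then obtain k where k: "k \<noteq> 0" "A = mat k ** B" by blast
  have "mat j ** B = mat (j / k) ** (mat k ** B)" for j
    using k by (simp add: matrix_mul_assoc mat_mult_mat)
  then show "proj_class A = proj_class B"
    unfolding proj_class_altdef k(2)
    by (auto simp: matrix_mul_assoc mat_mult_mat k(1)) (metis k(1) divide_eq_0_iff nonzero_eq_divide_eq)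
qed

lemma mob_eq_iff:
  "mob a b c d = mob a' b' c' d' \<longleftrightarrow>
     (\<exists>k. k \<noteq> 0 \<and> a = k * a' \<and> b = k * b' \<and> c = k * c' \<and> d = k * d')"
  unfolding mob_def proj_class_eq_iff by (simp add: mat2_simps)

lemma mob_eqI:
  assumes "k \<noteq> 0" "a = k * a'" "b = k * b'" "c = k * c'" "d = k * d'"
  shows "mob a b c d = mob a' b' c' d'"
  unfolding mob_eq_iff using assms by (intro exI[of _ k]) simp

lemma mob_mult:
  assumes "a * d - b * c \<noteq> 0" "a' * d' - b' * c' \<noteq> 0"
  shows "mob a b c d \<star> mob a' b' c' d' =
    mob (a * a' + b * c') (a * b' + b * d') (c * a' + d * c') (c * b' + d * d')"
proof -
  have "(vector [vector [a, b], vector [c, d]] :: 'a^2^2) ** (vector [vector [a', b'], vector [c', d']] :: 'a^2^2) =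
    vector [vector [a * a' + b * c', a * b' + b * d'], vector [c * a' + d * c', c * b' + d * d']]"
    by (simp add: vec_eq_iff forall_2 matrix_matrix_mult_def sum_2 vector_2)
  then show ?thesis
    using assms unfolding mob_def by (subst proj_class_mult) (simp_all add: det_2)
qed

lemma mob_carrier: "a * d - b * c \<noteq> 0 \<Longrightarrow> mob a b c d \<in> carrier (PGL2 UNIV)"
  unfolding mob_def by (rule proj_class_carrier) (simp add: det_2)

lemma proj_class_eq_mob: "proj_class A = mob (A $ 1 $ 1) (A $ 1 $ 2) (A $ 2 $ 1) (A $ 2 $ 2)"
  unfolding mob_def by (rule arg_cong[of _ _ proj_class]) (simp add: mat2_simps)

lemma pgl_carrier_eq: "carrier (PGL2 (UNIV :: 'a::field set)) = {proj_class A | A. det A \<noteq> 0}"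
  unfolding PGL2_def FactGroup_def RCOSETS_def proj_class_def by (auto simp: GL2_def)

lemma pgl_cases:
  assumes "x \<in> carrier (PGL2 UNIV)"
  obtains a b c d where "x = mob a b c d" "a * d - b * c \<noteq> 0"
  using assms unfolding pgl_carrier_eq by (auto simp: proj_class_eq_mob det_2)

lemma one_eq_mob: "\<one>\<^bsub>PGL2 (UNIV :: 'a::field set)\<^esub> = uni 0"
proof -
  have "proj_class (mat 1 :: 'a^2^2) = \<one>\<^bsub>PGL2 UNIV\<^esub>"
    by (subst proj_class_eq_one) (simp_all add: mat2_simps)
  then show ?thesis by (simp add: proj_class_eq_mob mat2_simps)
qed

lemma uni_eq_iff [simp]: "uni a = uni b \<longleftrightarrow> a = b"
  by (auto simp: mob_eq_iff)

lemma uni_mult: "uni a \<star> uni b = uni (a + b)"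
  by (simp add: mob_mult add.commute)

text \<open>An element commuting with \<open>uni 1\<close> preserves its only fixed point, infinity,
  so \<open>c = 0\<close>; the remaining entries give \<open>k = 1\<close> and
  \<open>d = a\<close>.\<close>

lemma commute_uni:
  assumes "x \<in> carrier (PGL2 UNIV)" "x \<star> uni 1 = uni 1 \<star> x"
  obtains b where "x = uni b"
proof -
  obtain a b c d where x: "x = mob a b c d" and det: "a * d - b * c \<noteq> 0"
    using assms(1) by (rule pgl_cases)
  obtain k where k: "k \<noteq> 0" "a = k * (a + c)" "a + b = k * (b + d)" "c = k * c" "c + d = k * d"
    using assms(2) det unfolding x by (auto simp: mob_mult mob_eq_iff)
  have c: "c = 0" using k by auto
  with k det have "k = 1" by auto
  with k have "d = a" by simp
  then have "x = uni (b / a)"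
    using det c unfolding x by (intro mob_eqI[of a]) auto
  then show ?thesis by (rule that)
qed

text \<open>As 2 is nonzero, \<open>dia (- 1)\<close> has exactly the fixed points 0 and infinity. A
  commuting element fixes both or swaps them; whether the scalar \<open>k\<close> is 1 tells the two
  cases apart.\<close>

lemma commute_dia:
  assumes "(2 :: 'a::field) \<noteq> 0" "x \<in> carrier (PGL2 (UNIV :: 'a set))" "x \<star> dia (- 1) = dia (- 1) \<star> x"
  obtains s where "s \<noteq> 0" "x = dia s" | s where "s \<noteq> 0" "x = anti s"
proof -
  obtain a b c d where x: "x = mob a b c d" and det: "a * d - b * c \<noteq> 0"
    using assms(2) by (rule pgl_cases)
  obtain k where k: "k \<noteq> 0" "- a = k * - a" "b = k * - b" "- c = k * c" "d = k * d"
    using assms(3) det unfolding x by (auto simp: mob_mult mob_eq_iff)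
  have self_neg: "y = 0" if "y = - y" for y :: 'a
    using that assms(1) by (metis add.inverse_inverse add_eq_0_iff mult_2 mult_eq_0_iff)
  show ?thesis
  proof (cases "k = 1")
    case True
    then have "b = 0" "c = 0" using k self_neg[of b] self_neg[of c] by auto
    then have "x = dia (a / d)" "a / d \<noteq> 0"
      using det unfolding x by (intro mob_eqI[of d], auto)
    then show ?thesis using that by blast
  next
    case False
    then have "a = 0" "d = 0" using k by auto
    then have "x = anti (c / b)" "c / b \<noteq> 0"
      using det unfolding x by (intro mob_eqI[of b], auto)
    then show ?thesis using that by blast
  qed
qed

text \<open>Serves to locate the image of \<open>Y\<close>, which conjugates \<open>u\<close> to its
  inverse: infinity is again preserved, and the linear coefficient is now -1.\<close>

lemma invert_uni:
  assumes "x \<in> carrier (PGL2 UNIV)" "x \<star> uni 1 = uni (- 1) \<star> x"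
  obtains b where "x = mob (- 1) b 0 1"
proof -
  obtain a b c d where x: "x = mob a b c d" and det: "a * d - b * c \<noteq> 0"
    using assms(1) by (rule pgl_cases)
  obtain k where k: "k \<noteq> 0" "a = k * (a - c)" "a + b = k * (b - d)" "c = k * c" "c + d = k * d"
    using assms(2) det unfolding x by (auto simp: mob_mult mob_eq_iff)
  have c: "c = 0" using k by auto
  with k det have "k = 1" by auto
  with k have "a = - d" by simp
  then have "x = mob (- 1) (b / d) 0 1"
    using det c unfolding x by (intro mob_eqI[of d]) auto
  then show ?thesis by (rule that)
qed

section \<open>Isomorphisms fixing a translation\<close>

text \<open>Subfields are sets inside one ambient field, so that \<open>GF q\<close>, the set of
  translation lengths in the group and a fixed field are treated alike. Closure under
  \<open>inverse\<close> includes 0, as \<open>inverse 0 = 0\<close>.\<close>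

locale field_subset =
  fixes F :: "'a::field set"
  assumes one_mem: "1 \<in> F"
    and diff_mem: "x \<in> F \<Longrightarrow> y \<in> F \<Longrightarrow> x - y \<in> F"
    and mult_mem: "x \<in> F \<Longrightarrow> y \<in> F \<Longrightarrow> x * y \<in> F"
    and inverse_mem: "x \<in> F \<Longrightarrow> inverse x \<in> F"
begin

lemma zero_mem: "0 \<in> F"
  using diff_mem[OF one_mem one_mem] by simp

lemma minus_mem: "x \<in> F \<Longrightarrow> - x \<in> F"
  using diff_mem[OF zero_mem, of x] by simp

lemma add_mem: "x \<in> F \<Longrightarrow> y \<in> F \<Longrightarrow> x + y \<in> F"
  using diff_mem[OF _ minus_mem, of x y] by simp

lemma divide_mem: "x \<in> F \<Longrightarrow> y \<in> F \<Longrightarrow> x / y \<in> F"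
  by (simp add: divide_inverse mult_mem inverse_mem)

lemma two_mem: "2 \<in> F"
  using add_mem[OF one_mem one_mem] by simp

lemmas mems = one_mem zero_mem two_mem diff_mem minus_mem add_mem mult_mem inverse_mem divide_mem

lemma power_mem: "x \<in> F \<Longrightarrow> x ^ n \<in> F"
  by (induction n) (auto intro: mems)

end

text \<open>Both sides are plain subsets under the multiplication of \<open>PGL2 UNIV\<close>, so
  that the isomorphism with a linear group and the automorphism \<open>\<sigma>\<close> are
  instances of one notion.\<close>

definition mult_iso :: "(('a::field^2^2) set \<Rightarrow> ('a^2^2) set) \<Rightarrow> ('a^2^2) set set \<Rightarrow> ('a^2^2) set set \<Rightarrow> bool" where
  "mult_iso \<psi> G H \<longleftrightarrow> bij_betw \<psi> G H \<and> (\<forall>x\<in>G. \<forall>y\<in>G. \<psi> (x \<star> y) = \<psi> x \<star> \<psi> y)"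

text \<open>The map \<open>g\<close> runs against \<open>\<psi>\<close>: it takes the translations
  known to lie in \<open>H\<close> back to translations in \<open>G\<close>, and so carries the
  field structure of \<open>F\<close> over to them. It serves twice, for the isomorphism with a
  linear group and for \<open>\<sigma>\<close>.\<close>

lemma fixed_iso_field_map:
  fixes F :: "'a::field set"
  assumes two: "(2 :: 'a) \<noteq> 0" and "field_subset F"
    and G: "subgroup G (PGL2 UNIV)" and iso: "mult_iso \<psi> G H"
    and gens: "uni 1 \<in> G" "dia (- 1) \<in> G" "anti w \<in> G"
    and \<psi>u: "\<psi> (uni 1) = uni 1" and \<psi>Y: "\<psi> (dia (- 1)) = dia (- 1)" and \<psi>X: "\<psi> (anti w) = anti d"
    and uni_H: "\<And>b. b \<in> F \<Longrightarrow> uni b \<in> H" and dia_H: "\<And>a. a \<in> F \<Longrightarrow> a \<noteq> 0 \<Longrightarrow> dia (a\<^sup>2) \<in> H"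
    and d: "d \<in> F" "d \<noteq> 0" and w: "w \<noteq> 0"
  obtains g where "\<And>b. b \<in> F \<Longrightarrow> uni (g b) \<in> G" "\<And>b. b \<in> F \<Longrightarrow> \<psi> (uni (g b)) = uni b"
    "\<And>a b. a \<in> F \<Longrightarrow> b \<in> F \<Longrightarrow> g (a + b) = g a + g b"
    "\<And>a b. a \<in> F \<Longrightarrow> b \<in> F \<Longrightarrow> g (a * b) = g a * g b"
    "g 1 = 1" "g d = w" "\<And>a. a \<in> F \<Longrightarrow> a \<noteq> 0 \<Longrightarrow> dia ((g a)\<^sup>2) \<in> G"
proof -
  interpret F: field_subset F by fact
  interpret G: subgroup G "PGL2 UNIV" by fact
  have hom: "\<psi> (x \<star> y) = \<psi> x \<star> \<psi> y" if "x \<in> G" "y \<in> G" for x y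
    using iso that by (auto simp: mult_iso_def)
  have inj: "x = y" if "\<psi> x = \<psi> y" "x \<in> G" "y \<in> G" for x y
    using iso that by (auto simp: mult_iso_def bij_betw_def dest: inj_onD)
  have onto: "\<exists>x\<in>G. \<psi> x = y" if "y \<in> H" for y
    using iso that unfolding mult_iso_def bij_betw_def by (metis imageE)
  have "\<exists>c. uni c \<in> G \<and> \<psi> (uni c) = uni b" if b: "b \<in> F" for b
  proof -
    obtain x where x: "x \<in> G" "\<psi> x = uni b" using onto[OF uni_H[OF b]] by blast
    \<comment> \<open>Injectivity of \<open>\<psi>\<close> pulls relations in \<open>H\<close> back
      to \<open>G\<close>: \<open>x\<close> commutes with \<open>u\<close> because its image is a
      translation.\<close>
    have "x \<star> uni 1 = uni 1 \<star> x"
      by (rule inj) (use x gens in \<open>simp_all add: hom \<psi>u uni_mult add.commute\<close>)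
    then obtain c where "x = uni c" using x(1) by (meson G.mem_carrier commute_uni)
    with x show ?thesis by blast
  qed
  then obtain g where g: "\<And>b. b \<in> F \<Longrightarrow> uni (g b) \<in> G" "\<And>b. b \<in> F \<Longrightarrow> \<psi> (uni (g b)) = uni b"
    by metis
  have g_eqI: "g b = c" if "b \<in> F" "uni c \<in> G" "\<psi> (uni c) = uni b" for b c
    using inj[of "uni (g b)" "uni c"] that g[OF that(1)] by simp
  have g1: "g 1 = 1" by (rule g_eqI) (simp_all add: F.mems gens \<psi>u)
  have g_add: "g (a + b) = g a + g b" if "a \<in> F" "b \<in> F" for a b
    using that hom[of "uni (g a)" "uni (g b)"] g[of a] g[of b] G.m_closed[of "uni (g a)" "uni (g b)"]
    by (intro g_eqI F.mems) (simp_all add: uni_mult)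
  have g0: "g 0 = 0" using g_add[of 0 0] F.zero_mem by (metis add_cancel_right_left add.right_neutral)
  have g_minus: "g (- a) = - g a" if "a \<in> F" for a
    using g_add[of a "- a"] that F.minus_mem[OF that] g0 by (simp add: eq_neg_iff_add_eq_0 add.commute)
  \<comment> \<open>Conjugation by \<open>dia (a\<^sup>2)\<close> multiplies translation lengths by
    \<open>a\<^sup>2\<close>. Its preimage \<open>x\<close> commutes with \<open>Y\<close>, so it is
    diagonal or antidiagonal; the latter is excluded because \<open>x\<close> conjugates
    \<open>u\<close> to a translation.\<close>
  have torus: "\<exists>s. dia s \<in> G \<and> (\<forall>b\<in>F. g (a\<^sup>2 * b) = s * g b)" if a: "a \<in> F" "a \<noteq> 0" for a
  proof -
    obtain x where x: "x \<in> G" "\<psi> x = dia (a\<^sup>2)" using onto[OF dia_H[OF a]] by blast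
    have comm: "x \<star> dia (- 1) = dia (- 1) \<star> x"
      by (rule inj) (use x gens a in \<open>simp_all add: hom \<psi>Y mob_mult\<close>)
    have conj: "x \<star> uni (g b) = uni (g (a\<^sup>2 * b)) \<star> x" if b: "b \<in> F" for b
      by (rule inj) (use x a b in \<open>simp_all add: hom g F.mems F.power_mem mob_mult\<close>)
    show ?thesis
    proof (rule commute_dia[OF two G.mem_carrier[OF x(1)] comm])
      fix s assume 1: "s \<noteq> 0" "x = dia s"
      have "g (a\<^sup>2 * b) = s * g b" if "b \<in> F" for b
        using conj[OF that] 1(1) unfolding 1(2) by (auto simp: mob_mult mob_eq_iff)
      then show ?thesis using 1 x by auto
    next
      fix s assume 2: "s \<noteq> 0" "x = anti s"
      then have False
        using conj[OF F.one_mem] 2(1) unfolding 2(2) by (auto simp: mob_mult mob_eq_iff g1)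
      then show ?thesis ..
    qed
  qed
  have g_sq: "g (a\<^sup>2 * b) = g (a\<^sup>2) * g b" if "a \<in> F" "b \<in> F" for a b
  proof (cases "a = 0")
    case False
    from torus[OF that(1) False] obtain s where "\<forall>b\<in>F. g (a\<^sup>2 * b) = s * g b" by blast
    then show ?thesis using that F.one_mem g1 by (metis mult.right_neutral)
  qed (simp add: g0)
  have g_mult: "g (a * b) = g a * g b" if "a \<in> F" "b \<in> F" for a b
  proof -
    \<comment> \<open>\<open>a\<close> is the difference of these two squares, which reduces multiplicativity to \<open>g_sq\<close>.\<close>
    define x y where "x = (a + 1) / 2" and "y = (a - 1) / 2"
    have xy: "x \<in> F" "y \<in> F" using that by (simp_all add: x_def y_def F.mems)
    have "x\<^sup>2 - y\<^sup>2 = (x + y) * (x - y)" by (simp add: power2_eq_square algebra_simps)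
    also have "x + y = a" using two by (simp add: x_def y_def flip: add_divide_distrib)
    also have "x - y = 1" using two by (simp add: x_def y_def flip: diff_divide_distrib)
    finally have a: "a = x\<^sup>2 + - (y\<^sup>2)" by simp
    have "a * b = x\<^sup>2 * b + - (y\<^sup>2 * b)" by (simp add: a algebra_simps)
    also have "g \<dots> = g (x\<^sup>2 * b) - g (y\<^sup>2 * b)"
      using xy that by (subst g_add) (simp_all add: g_minus F.mems F.power_mem)
    also have "\<dots> = (g (x\<^sup>2) - g (y\<^sup>2)) * g b"
      using xy that by (simp add: g_sq left_diff_distrib)
    also have "g (x\<^sup>2) - g (y\<^sup>2) = g a"
      unfolding a using xy by (subst g_add) (simp_all add: g_minus F.mems F.power_mem)
    finally show ?thesis .
  qed
  have "dia ((g a)\<^sup>2) \<in> G" if "a \<in> F" "a \<noteq> 0" for a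
  proof -
    obtain s where s: "dia s \<in> G" "\<forall>b\<in>F. g (a\<^sup>2 * b) = s * g b"
      using torus \<open>a \<in> F\<close> \<open>a \<noteq> 0\<close> by blast
    then have "s = g (a\<^sup>2)" using F.one_mem g1 by (metis mult.right_neutral)
    then show ?thesis using s g_mult[of a a] \<open>a \<in> F\<close> by (simp add: power2_eq_square)
  qed
  moreover have "g d = w"
  proof -
    \<comment> \<open>\<open>u X u\<^sub>b X u\<close> is antidiagonal for the image \<open>anti d\<close> of \<open>X\<close>, hence commutes with \<open>Y\<close>;
      pulled back along \<open>\<psi>\<close> this forces \<open>w * g b = - 1\<close>.\<close>
    define b where "b = - inverse d"
    have b: "b \<in> F" using d by (simp add: b_def F.mems)
    define x where "x = uni 1 \<star> anti w \<star> uni (g b) \<star> anti w \<star> uni 1"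
    have x: "x \<in> G" using gens g b by (simp add: x_def)
    have "\<psi> x = uni 1 \<star> anti d \<star> uni b \<star> anti d \<star> uni 1"
      using gens g b by (simp add: x_def hom \<psi>u \<psi>X)
    also have "\<dots> = mob 0 d (- d) 0"
      using d by (simp add: mob_mult b_def algebra_simps)
    finally have \<psi>x: "\<psi> x = mob 0 d (- d) 0" .
    have comm: "x \<star> dia (- 1) = dia (- 1) \<star> x"
      by (rule inj) (use x gens d in \<open>simp_all add: hom \<psi>Y \<psi>x mob_mult mob_eq_iff, auto intro!: exI[of _ "-1"]\<close>)
    have x_eq: "x = mob (w * (w * g b) + w) (w * (w * g b) + w + w) (w * (w * g b)) (w * (w * g b) + w)"
      using w by (simp add: x_def mob_mult algebra_simps)
    have "w * g b = - 1"
    proof (rule commute_dia[OF two G.mem_carrier[OF x] comm])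
      \<comment> \<open>For a diagonal \<open>x\<close> both off-diagonal entries vanish, which
        would force \<open>w + w = 0\<close>.\<close>
      fix s assume "x = dia s"
      with x_eq have eq: "mob (w * (w * g b) + w) (w * (w * g b) + w + w) (w * (w * g b)) (w * (w * g b) + w) = dia s"
        by simp
      have 1: "w * (w * g b) = 0" using eq unfolding mob_eq_iff by auto
      have 2: "w * (w * g b) + w + w = 0" using eq unfolding mob_eq_iff by auto
      have "w + w = 0" using 2 unfolding 1 by simp
      then show ?thesis using two w by (metis mult_2 mult_eq_0_iff)
    next
      fix s assume "x = anti s"
      then have "w * (w * g b + 1) = 0"
        using x_eq by (auto simp: mob_eq_iff algebra_simps)
      then show ?thesis using w by (simp add: eq_neg_iff_add_eq_0)
    qed
    moreover have "g d * g b = - 1"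
      using g_mult[OF d(1) b] d g_minus[OF F.one_mem] by (simp add: b_def g1)
    ultimately show ?thesis by (metis mult_cancel_right mult_zero_right neg_equal_0_iff_equal zero_neq_one)
  qed
  ultimately show ?thesis using that g g_add g_mult g1 by blast
qed

section \<open>Normalising an isomorphism by conjugation\<close>

text \<open>The copy of PGL(2, F) inside PGL(2, K): classes modulo scalars of the big field that
  have a representative over \<open>F\<close>.\<close>

definition pgl_points :: "'a::field set \<Rightarrow> ('a^2^2) set set" where
  "pgl_points F = {mob a b c d | a b c d. a \<in> F \<and> b \<in> F \<and> c \<in> F \<and> d \<in> F \<and> a * d - b * c \<noteq> 0}"

lemma pgl_pointsI:
  "a \<in> F \<Longrightarrow> b \<in> F \<Longrightarrow> c \<in> F \<Longrightarrow> d \<in> F \<Longrightarrow> a * d - b * c \<noteq> 0 \<Longrightarrow> mob a b c d \<in> pgl_points F"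
  unfolding pgl_points_def by blast

lemma pgl_points_subset: "pgl_points F \<subseteq> carrier (PGL2 UNIV)"
  unfolding pgl_points_def by (auto intro: mob_carrier)

lemma inv_mob:
  assumes "a * d - b * c \<noteq> 0"
  shows "inv\<^bsub>PGL2 UNIV\<^esub> mob a b c d = mob d (- b) (- c) a"
proof (rule PGL.inv_equality)
  show "mob d (- b) (- c) a \<star> mob a b c d = \<one>\<^bsub>PGL2 UNIV\<^esub>"
    unfolding one_eq_mob using assms
    by (subst mob_mult; (rule mob_eqI[of "a * d - b * c"])?) (simp_all add: algebra_simps)
qed (use assms in \<open>auto intro!: mob_carrier simp: algebra_simps\<close>)

context field_subset
begin

lemma pgl_points_inv:
  assumes "x \<in> pgl_points F"
  shows "inv\<^bsub>PGL2 UNIV\<^esub> x \<in> pgl_points F"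
  using assms unfolding pgl_points_def
  by (auto simp: inv_mob) (rule exI conjI refl mems | assumption | simp add: algebra_simps)+

text \<open>The entry 1 determines the scalar between the two representatives as the inverse of an
  element of \<open>F\<close>.\<close>

lemma pgl_points_last:
  assumes "mob a b c 1 \<in> pgl_points F"
  shows "a \<in> F" "b \<in> F" "c \<in> F"
proof -
  obtain a' b' c' d' k where *: "a' \<in> F" "b' \<in> F" "c' \<in> F" "d' \<in> F"
    "k \<noteq> 0" "a = k * a'" "b = k * b'" "c = k * c'" "1 = k * d'"
    using assms unfolding pgl_points_def by (auto simp: mob_eq_iff)
  then have "k = inverse d'"
    by (metis inverse_unique mult.commute)
  then have "k \<in> F" using * mems by simp
  then show "a \<in> F" "b \<in> F" "c \<in> F" using * mems by simp_all
qed

lemma pgl_points_anti: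
  assumes "anti s \<in> pgl_points F"
  shows "s \<in> F"
proof -
  obtain b' c' k where *: "b' \<in> F" "c' \<in> F" "k \<noteq> 0" "1 = k * b'" "s = k * c'"
    using assms unfolding pgl_points_def by (auto simp: mob_eq_iff)
  then have "k = inverse b'"
    by (metis inverse_unique mult.commute)
  with * show "s \<in> F" using mems by simp
qed

end

section \<open>Eigenvalues and elements of order p\<close>

lemma eigenvector_exists:
  fixes a b c d l :: "'a::field"
  assumes "(l - a) * (l - d) = b * c"
  obtains v :: "'a^2" where "v \<noteq> 0" "vector [vector [a, b], vector [c, d]] *v v = l *s v"
proof -
  define A :: "'a^2^2" where "A = vector [vector [a, b], vector [c, d]]"
  have *: "A *v vector [x, y] = l *s vector [x, y]" if "a * x + b * y = l * x" "c * x + d * y = l * y" for x y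
    using that by (simp add: A_def vec_eq_iff forall_2 matrix_vector_mult_def sum_2 vector_2)
  have nz: "vector [x, y] \<noteq> (0 :: 'a^2)" if "x \<noteq> 0 \<or> y \<noteq> 0" for x y
    using that by (auto simp: vec_eq_iff forall_2 vector_2)
  consider "b \<noteq> 0 \<or> l \<noteq> a" | "c \<noteq> 0 \<or> l \<noteq> d" | "b = 0" "l = d" by blast
  then show ?thesis
  proof cases
    case 1
    show ?thesis
      by (rule that[of "vector [b, l - a]"], rule nz, use 1 in simp, fold A_def, rule *)
         (use assms in \<open>simp_all add: algebra_simps\<close>)
  next
    case 2
    show ?thesis
      by (rule that[of "vector [l - d, c]"], rule nz, use 2 in force, fold A_def, rule *)
         (use assms in \<open>simp_all add: algebra_simps\<close>)
  next
    case 3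
    show ?thesis
      by (rule that[of "vector [0, 1]"], rule nz, simp, fold A_def, rule *)
         (use 3 in \<open>simp_all add: algebra_simps\<close>)
  qed
qed

lemma matrix_power_eigenvector:
  fixes A :: "'a::field^2^2"
  assumes "A *v v = l *s v"
  shows "((((**) A) ^^ n) (mat 1)) *v v = l ^ n *s v"
proof (induction n)
  case (Suc n)
  have "((((**) A) ^^ Suc n) (mat 1)) *v v = A *v (l ^ n *s v)"
    by (simp add: Suc flip: matrix_vector_mul_assoc)
  also have "\<dots> = l ^ n *s (A *v v)"
    by (simp add: vec_eq_iff matrix_vector_mult_def sum_distrib_left mult_ac)
  finally show ?case by (simp add: assms vector_smult_assoc mult.commute)
qed simp

text \<open>A representative of \<open>x\<close> has a double eigenvalue m, so it is m plus a
  nilpotent matrix N. As m is half the trace, it lies in \<open>F\<close>, and a Jordan basis can be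
  written down over \<open>F\<close>.\<close>

lemma order_char_conjugate_uni:
  fixes F :: "'a::alg_closed_field set"
  assumes "field_subset F" and two: "(2 :: 'a) \<noteq> 0" and p: "prime p" "CHAR('a) = p"
    and x: "x \<in> pgl_points F" "x \<noteq> \<one>\<^bsub>PGL2 UNIV\<^esub>" "x [^]\<^bsub>PGL2 UNIV\<^esub> p = \<one>\<^bsub>PGL2 UNIV\<^esub>"
  obtains q where "q \<in> pgl_points F" "x \<star> q = q \<star> uni 1"
proof -
  interpret field_subset F by fact
  obtain a b c d where xe: "x = mob a b c d" and F: "a \<in> F" "b \<in> F" "c \<in> F" "d \<in> F"
    and det: "a * d - b * c \<noteq> 0"
    using x(1) unfolding pgl_points_def by blast
  define A :: "'a^2^2" where "A = vector [vector [a, b], vector [c, d]]"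
  have dA: "det A \<noteq> 0" using det by (simp add: A_def det_2)
  \<comment> \<open>\<open>y\<close> is a square root of the discriminant, so the eigenvalues are
    \<open>(a + d + y) / 2\<close> and \<open>(a + d - y) / 2\<close>.\<close>
  obtain y where y: "y\<^sup>2 = (a - d)\<^sup>2 + 4 * (b * c)"
    using nth_root_exists[of 2] by auto
  obtain k where k: "(((**) A) ^^ p) (mat 1) = mat k"
  proof -
    have "proj_class ((((**) A) ^^ p) (mat 1)) = \<one>\<^bsub>PGL2 UNIV\<^esub>"
      using x(3) unfolding xe mob_def A_def[symmetric] by (simp add: proj_class_pow dA)
    then have "(((**) A) ^^ p) (mat 1) = mat (((((**) A) ^^ p) (mat 1) :: 'a^2^2) $ 1 $ 1)"
      by (subst (asm) proj_class_eq_one[OF det_power[OF dA]])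
         (auto simp: vec_eq_iff forall_2 mat_def[of "_ :: 'a"])
    then show ?thesis by (rule that)
  qed
  \<comment> \<open>Both eigenvalues of \<open>A\<close> are \<open>p\<close>-th roots of \<open>k\<close>, so they coincide and the discriminant vanishes.\<close>
  have root: "((a + d + z) / 2) ^ p = k" if z: "z\<^sup>2 = y\<^sup>2" for z
  proof -
    define l where "l = (a + d + z) / 2"
    have l: "l * 2 = a + d + z" using two by (simp add: l_def)
    have "4 * ((l - a) * (l - d)) = (l * 2 - 2 * a) * (l * 2 - 2 * d)"
      by (simp add: algebra_simps)
    also have "\<dots> = z\<^sup>2 - (a - d)\<^sup>2"
      unfolding l by (simp add: power2_eq_square algebra_simps)
    also have "\<dots> = 4 * (b * c)" using z y by simp
    finally have "2 * (2 * ((l - a) * (l - d) - b * c)) = 0" by simp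
    then have "(l - a) * (l - d) = b * c" using two by (metis eq_iff_diff_eq_0 mult_eq_0_iff)
    then obtain v :: "'a^2" where v: "v \<noteq> 0" "A *v v = l *s v"
      unfolding A_def by (rule eigenvector_exists)
    have "mat k *v v = l ^ p *s v"
      using matrix_power_eigenvector[OF v(2), of p] unfolding k .
    then show ?thesis
      using v(1) unfolding l_def[symmetric]
      by (auto simp: vec_eq_iff forall_2 matrix_vector_mult_def sum_2 mat_def)
  qed
  have "y = 0"
  proof -
    \<comment> \<open>The eigenvalues differ by \<open>y\<close>, and p-th powers are additive in
      characteristic p.\<close>
    have "((a + d + y) / 2) = (a + d + - y) / 2 + y" using two by (simp add: field_simps)
    then have "((a + d + y) / 2) ^ p = ((a + d + - y) / 2) ^ p + y ^ p"
      using freshmans_dream[of p] p by metis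
    then have "y ^ p = 0" using root[of y] root[of "- y"] by simp
    then show ?thesis by simp
  qed
  then have disc: "(a - d)\<^sup>2 + 4 * (b * c) = 0" using y by simp
  \<comment> \<open>\<open>m\<close> is the double eigenvalue, and the nilpotent part N has the rows
    \<open>(n, b)\<close> and \<open>(c, - n)\<close>.\<close>
  define m where "m = (a + d) / 2"
  define n where "n = (a - d) / 2"
  have mn: "a = m + n" "d = m - n"
    using two by (simp_all add: m_def n_def flip: add_divide_distrib diff_divide_distrib)
  have mF: "m \<in> F" "n \<in> F" using F by (simp_all add: m_def n_def mems)
  have "a - d = 2 * n" by (simp add: mn)
  then have "2 * (2 * (n * n + b * c)) = 0"
    using disc by (simp add: power2_eq_square algebra_simps)
  then have "n * n + b * c = 0" using two by (metis mult_eq_0_iff)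
  then have nil: "n * n = - (b * c)" by (simp add: eq_neg_iff_add_eq_0)
  have "a * d - b * c = m * m" using nil by (simp add: mn algebra_simps)
  then have m: "m \<noteq> 0" using det by auto
  show ?thesis
  proof (cases "c = 0")
    case False
    \<comment> \<open>The columns of the conjugating matrix are N e and m e for the first unit
      vector e.\<close>
    show ?thesis
    proof (rule that)
      show "mob n m c 0 \<in> pgl_points F"
        using False m F mF by (intro pgl_pointsI) (auto simp: mems)
      show "x \<star> mob n m c 0 = mob n m c 0 \<star> uni 1"
        unfolding xe using False m det nil mn
        by (simp add: mob_mult) (rule mob_eqI[of m]; simp add: algebra_simps)
    qed
  next
    case True
    then have "n = 0" using nil by simp
    have b: "b \<noteq> 0"
    proof
      assume "b = 0"
      then have "x = uni 0" unfolding xe using True \<open>n = 0\<close> mn m by (intro mob_eqI[of m]) auto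
      then show False using x(2) by (simp add: one_eq_mob)
    qed
    \<comment> \<open>The same with the second unit vector, which N sends to
      \<open>(b, 0)\<close>.\<close>
    show ?thesis
    proof (rule that)
      show "mob b 0 0 m \<in> pgl_points F"
        using b m F mF by (intro pgl_pointsI) (auto simp: mems)
      show "x \<star> mob b 0 0 m = mob b 0 0 m \<star> uni 1"
        unfolding xe using True \<open>n = 0\<close> m b mn
        by (simp add: mob_mult) (rule mob_eqI[of m]; simp add: algebra_simps)
    qed
  qed
qed

section \<open>Conjugating isomorphisms over \<open>F\<close>\<close>

lemma mult_iso_conj:
  assumes iso: "mult_iso \<psi> G H" and H: "H \<subseteq> carrier (PGL2 UNIV)" and q: "q \<in> carrier (PGL2 UNIV)"
    and conj: "\<And>x. x \<in> H \<Longrightarrow> q \<star> x \<star> inv\<^bsub>PGL2 UNIV\<^esub> q \<in> H" "\<And>x. x \<in> H \<Longrightarrow> inv\<^bsub>PGL2 UNIV\<^esub> q \<star> x \<star> q \<in> H"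
  shows "mult_iso (\<lambda>x. inv\<^bsub>PGL2 UNIV\<^esub> q \<star> \<psi> x \<star> q) G H"
proof -
  let ?i = "inv\<^bsub>PGL2 UNIV\<^esub> q"
  have i: "?i \<in> carrier (PGL2 UNIV)" using q by simp
  have c: "x \<in> carrier (PGL2 UNIV)" if "x \<in> H" for x using that H by blast
  have canc: "q \<star> (?i \<star> x) = x" "?i \<star> (q \<star> x) = x" if "x \<in> carrier (PGL2 UNIV)" for x
    using that q by (simp_all flip: PGL.m_assoc)
  have bij: "bij_betw (\<lambda>x. ?i \<star> x \<star> q) H H"
    by (rule bij_betwI[where g = "\<lambda>x. q \<star> x \<star> ?i"])
       (use q i c conj in \<open>auto simp: PGL.m_assoc canc\<close>)
  have \<psi>: "\<psi> x \<in> H" if "x \<in> G" for x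
    using iso that by (auto simp: mult_iso_def bij_betw_def)
  have "?i \<star> \<psi> (x \<star> y) \<star> q = (?i \<star> \<psi> x \<star> q) \<star> (?i \<star> \<psi> y \<star> q)" if "x \<in> G" "y \<in> G" for x y
  proof -
    have "\<psi> (x \<star> y) = \<psi> x \<star> \<psi> y" using iso that by (simp add: mult_iso_def)
    then show ?thesis using that q i c[OF \<psi>] by (simp add: PGL.m_assoc canc)
  qed
  then show ?thesis
    using iso bij_betw_trans[OF _ bij, of \<psi> G] by (auto simp: mult_iso_def o_def)
qed

text \<open>The image of \<open>u\<close> has order p, so a conjugation over \<open>F\<close>
  returns it to \<open>u\<close>. Then the image of \<open>Y\<close> inverts \<open>u\<close>, so it
  is z -> b - z, and conjugation by a translation turns it into \<open>Y\<close>. Finally the image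
  of \<open>X\<close> commutes with \<open>Y\<close> and has to be antidiagonal.\<close>

lemma normalized_iso_exists:
  fixes F :: "'a::alg_closed_field set"
  assumes "field_subset F" and two: "(2 :: 'a) \<noteq> 0" and p: "prime p" "CHAR('a) = p"
    and G: "subgroup G (PGL2 UNIV)" and iso: "mult_iso \<psi> G H" and H: "H \<subseteq> pgl_points F"
    and conj: "\<And>q x. q \<in> pgl_points F \<Longrightarrow> x \<in> H \<Longrightarrow> q \<star> x \<star> inv\<^bsub>PGL2 UNIV\<^esub> q \<in> H"
    and gens: "uni 1 \<in> G" "dia (- 1) \<in> G" "anti w \<in> G" and w: "w \<noteq> 0"
  obtains \<phi> d where "mult_iso \<phi> G H" "\<phi> (uni 1) = uni 1" "\<phi> (dia (- 1)) = dia (- 1)"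
    "\<phi> (anti w) = anti d" "d \<in> F" "d \<noteq> 0"
proof -
  interpret F: field_subset F by fact
  interpret G: subgroup G "PGL2 UNIV" by fact
  have Hc: "H \<subseteq> carrier (PGL2 UNIV)" using H pgl_points_subset by blast
  have image: "f x \<in> H" if "mult_iso f G H" "x \<in> G" for f x
    using that by (auto simp: mult_iso_def bij_betw_def)
  have imagec: "f x \<in> carrier (PGL2 UNIV)" if "mult_iso f G H" "x \<in> G" for f x
    using image[OF that] Hc by blast
  have hom: "f (x \<star> y) = f x \<star> f y" if "mult_iso f G H" "x \<in> G" "y \<in> G" for f x y
    using that by (auto simp: mult_iso_def)
  have inj: "x = y" if "mult_iso f G H" "f x = f y" "x \<in> G" "y \<in> G" for f x y
    using that by (auto simp: mult_iso_def bij_betw_def dest: inj_onD)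
  have one: "f (uni 0) = \<one>\<^bsub>PGL2 UNIV\<^esub>" if f: "mult_iso f G H" for f
    using hom[OF f G.one_closed G.one_closed] imagec[OF f G.one_closed]
    by (simp add: one_eq_mob[symmetric])
  have conj': "mult_iso (\<lambda>x. inv\<^bsub>PGL2 UNIV\<^esub> q \<star> f x \<star> q) G H"
    if f: "mult_iso f G H" and q: "q \<in> pgl_points F" for f q
  proof (rule mult_iso_conj[OF f Hc])
    show "q \<in> carrier (PGL2 UNIV)" using q pgl_points_subset by blast
    then show "inv\<^bsub>PGL2 UNIV\<^esub> q \<star> x \<star> q \<in> H" if "x \<in> H" for x
      using conj[OF F.pgl_points_inv[OF q] that] by simp
  qed (rule conj[OF q])
  \<comment> \<open>\<open>uni (of_nat n)\<close> is the n-th power of \<open>u\<close>; for n = p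
    it is the identity.\<close>
  have pow: "uni (of_nat n) \<in> G \<and> \<psi> (uni (of_nat n)) = \<psi> (uni 1) [^]\<^bsub>PGL2 UNIV\<^esub> n" for n
  proof (induction n)
    case 0
    show ?case using G.one_closed one[OF iso] by (simp add: one_eq_mob)
  next
    case (Suc n)
    then show ?case
      using hom[OF iso _ gens(1), of "uni (of_nat n)"] G.m_closed[OF _ gens(1), of "uni (of_nat n)"]
      by (simp add: uni_mult add.commute)
  qed
  have "\<psi> (uni 1) [^]\<^bsub>PGL2 UNIV\<^esub> p = \<one>\<^bsub>PGL2 UNIV\<^esub>"
    using pow[of p] p one[OF iso] by (metis of_nat_CHAR)
  moreover have "\<psi> (uni 1) \<noteq> \<one>\<^bsub>PGL2 UNIV\<^esub>"
    using inj[OF iso, of "uni 1" "uni 0"] one[OF iso] gens G.one_closed by (auto simp: one_eq_mob)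
  ultimately obtain q where q: "q \<in> pgl_points F" "\<psi> (uni 1) \<star> q = q \<star> uni 1"
    using order_char_conjugate_uni[OF \<open>field_subset F\<close> two p] image[OF iso gens(1)] H by blast
  have qc: "q \<in> carrier (PGL2 UNIV)" using q pgl_points_subset by blast
  define \<psi>1 where "\<psi>1 = (\<lambda>x. inv\<^bsub>PGL2 UNIV\<^esub> q \<star> \<psi> x \<star> q)"
  have iso1: "mult_iso \<psi>1 G H" unfolding \<psi>1_def by (rule conj'[OF iso q(1)])
  have "uni (1 :: 'a) \<in> carrier (PGL2 UNIV)" by (rule mob_carrier) simp
  then have u1: "\<psi>1 (uni 1) = uni 1"
    using q(2) qc imagec[OF iso gens(1)]
    by (simp add: \<psi>1_def PGL.m_assoc) (simp flip: PGL.m_assoc)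

  have inv_u: "uni (- 1) \<in> G" "\<psi>1 (uni (- 1)) = uni (- 1)"
  proof -
    have *: "inv\<^bsub>PGL2 UNIV\<^esub> uni 1 = uni (- 1 :: 'a)" by (simp add: inv_mob)
    then show G': "uni (- 1) \<in> G" using G.m_inv_closed[OF gens(1)] by simp
    have "\<psi>1 (uni (- 1)) \<star> uni 1 = \<one>\<^bsub>PGL2 UNIV\<^esub>"
      using hom[OF iso1 G' gens(1)] one[OF iso1] by (simp add: u1 uni_mult)
    then show "\<psi>1 (uni (- 1)) = uni (- 1)"
      using PGL.inv_equality[of "\<psi>1 (uni (- 1))" "uni 1"] imagec[OF iso1 G'] \<open>uni 1 \<in> carrier _\<close> *
      by simp
  qed
  have "\<psi>1 (dia (- 1)) \<star> uni 1 = uni (- 1) \<star> \<psi>1 (dia (- 1))"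
    using hom[OF iso1 gens(2,1)] hom[OF iso1 inv_u(1) gens(2)]
    by (simp add: u1 inv_u mob_mult mob_eq_iff)
  then obtain b where b: "\<psi>1 (dia (- 1)) = mob (- 1) b 0 1"
    using imagec[OF iso1 gens(2)] by (rule_tac invert_uni) auto
  have bF: "b \<in> F"
    using F.pgl_points_last[of "- 1" b 0] image[OF iso1 gens(2)] H unfolding b by blast
  \<comment> \<open>\<open>b / 2\<close> is the fixed point of z -> b - z. Conjugation by
    \<open>uni s\<close> moves it to 0 and leaves \<open>u\<close> alone.\<close>
  define s where "s = b / 2"
  have sF: "s \<in> F" using bF by (simp add: s_def F.mems)
  have s: "s + s = b" using two by (simp add: s_def field_simps)
  define \<psi>2 where "\<psi>2 = (\<lambda>x. inv\<^bsub>PGL2 UNIV\<^esub> uni s \<star> \<psi>1 x \<star> uni s)"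
  have "uni s \<in> pgl_points F" using sF by (intro pgl_pointsI) (auto simp: F.mems)
  then have iso2: "mult_iso \<psi>2 G H" unfolding \<psi>2_def by (rule conj'[OF iso1])
  have u2: "\<psi>2 (uni 1) = uni 1"
    by (simp add: \<psi>2_def u1 inv_mob uni_mult)
  have Y2: "\<psi>2 (dia (- 1)) = dia (- 1)"
    by (simp add: \<psi>2_def b inv_mob mob_mult flip: s)
  have "\<psi>2 (anti w) \<star> dia (- 1) = dia (- 1) \<star> \<psi>2 (anti w)"
  proof -
    have "anti w \<star> dia (- 1) = dia (- 1) \<star> anti w"
      using w by (simp add: mob_mult) (rule mob_eqI[of "- 1"]; simp)
    then show ?thesis using hom[OF iso2 gens(3,2)] hom[OF iso2 gens(2,3)] unfolding Y2 by metis
  qed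
  then show ?thesis
  proof (rule commute_dia[OF two imagec[OF iso2 gens(3)]])
    \<comment> \<open>If the image of \<open>X\<close> were \<open>dia s\<close>, then
      \<open>s * s = 1\<close> and \<open>X u X\<close> would map to \<open>uni s\<close>, hence
      commute with \<open>u\<close>. But \<open>X u X\<close> moves infinity, so it is no
      translation.\<close>
    fix s assume s: "s \<noteq> 0" "\<psi>2 (anti w) = dia s"
    have "anti w \<star> anti w = uni 0"
      using w by (simp add: mob_mult) (rule mob_eqI[of w]; simp)
    then have "dia s \<star> dia s = uni 0"
      using hom[OF iso2 gens(3,3)] one[OF iso2] s(2) by (simp add: one_eq_mob)
    then have ss: "s * s = 1" using s(1) by (auto simp: mob_mult mob_eq_iff)
    define x where "x = anti w \<star> uni 1 \<star> anti w"
    have x: "x \<in> G" using gens by (simp add: x_def)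
    have "\<psi>2 x = dia s \<star> uni 1 \<star> dia s" using gens by (simp add: x_def hom[OF iso2] u2 s)
    also have "\<dots> = uni s" using s(1) ss by (simp add: mob_mult)
    finally have "x \<star> uni 1 = uni 1 \<star> x"
      using x gens by - (rule inj[OF iso2], simp_all add: hom[OF iso2] u2 uni_mult add.commute)
    then obtain b where "x = uni b"
      using x by (meson G.mem_carrier commute_uni)
    moreover have "x = mob w 0 (w * w) w"
      using w by (simp add: x_def mob_mult)
    ultimately have False using w by (auto simp: mob_eq_iff)
    then show ?thesis ..
  next
    fix d assume d: "d \<noteq> 0" "\<psi>2 (anti w) = anti d"
    then have "d \<in> F"
      using F.pgl_points_anti[of d] image[OF iso2 gens(3)] H by auto
    then show ?thesis using that[OF iso2 u2 Y2 d(2)] d(1) by blast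
  qed
qed

section \<open>Finite fields\<close>

lemma power_diff_char:
  fixes x y :: "'a::field"
  assumes "prime p" "CHAR('a) = p"
  shows "(x - y) ^ (p ^ n) = x ^ (p ^ n) - y ^ (p ^ n)"
proof -
  have "(x - y + y) ^ (p ^ n) = (x - y) ^ (p ^ n) + y ^ (p ^ n)"
    using assms by (intro freshmans_dream') auto
  then show ?thesis by simp
qed

lemma field_subset_GF:
  assumes "prime p" "CHAR('a::field) = p"
  shows "field_subset (GF (p ^ e) :: 'a set)"
  by standard
     (auto simp: GF_def power_diff_char[OF assms] power_mult_distrib power_inverse)

text \<open>The polynomial \<open>P\<close> splits over an algebraically closed field, and its
  derivative is the constant -1, so its q roots are distinct.\<close>

lemma card_GF:
  assumes "prime p" "CHAR('a::alg_closed_field) = p" "e > 0"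
  shows "card (GF (p ^ e) :: 'a set) = p ^ e"
proof -
  define q where "q = p ^ e"
  have q: "q > 1"
    unfolding q_def by (rule one_less_power[OF prime_gt_1_nat[OF assms(1)] assms(3)])
  define P :: "'a poly" where "P = monom 1 q - [:0, 1:]"
  have poly_P: "poly P x = x ^ q - x" for x by (simp add: P_def poly_monom)
  have deg: "degree P = q"
    unfolding P_def diff_conv_add_uminus
    by (subst degree_add_eq_left) (use q in \<open>simp_all add: degree_monom_eq\<close>)
  then have P0: "P \<noteq> 0" using q by auto
  have "of_nat q = (0 :: 'a)"
    using assms by (simp add: q_def of_nat_eq_0_iff_char_dvd)
  then have deriv: "pderiv P = [:- 1:]"
    by (simp add: P_def pderiv_diff pderiv_monom pderiv_pCons)
  have order: "order x P \<le> 1" for x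
  proof (rule ccontr)
    assume "\<not> order x P \<le> 1"
    then have "[:- x, 1:]\<^sup>2 dvd P" by (simp add: order_divides)
    then obtain Q where Q: "P = [:- x, 1:]\<^sup>2 * Q" by blast
    obtain L where "P = L * (L * Q)" and "poly L x = 0"
      by (rule that[of "[:- x, 1:]"]) (simp_all only: Q power2_eq_square mult.assoc, simp)
    then have "poly (pderiv P) x = 0" by (simp add: pderiv_mult)
    then show False by (simp add: deriv)
  qed
  obtain A where A: "size A = degree P" "P = smult (lead_coeff P) (\<Prod>x\<in>#A. [:-x, 1:])"
    using alg_closed_imp_factorization[OF P0] by blast
  have "proots P = proots (\<Prod>x\<in>#A. [:-x, 1:])"
    by (subst A(2)) (use P0 in simp)
  also have "\<dots> = A"
  proof (induction A)
    case (add x A)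
    have "(\<Prod>x\<in>#A. [:- x, 1:]) \<noteq> 0" by (auto simp: prod_mset_zero_iff)
    then have "proots ([:- x, 1:] * (\<Prod>x\<in>#A. [:- x, 1:])) = add_mset x A"
      by (subst proots_mult) (use add in simp_all)
    then show ?case by simp
  qed simp
  finally have pA: "proots P = A" .
  have "count A x = 1" if "x \<in># A" for x
    using order[of x] that P0 by (simp add: order_root Suc_leI le_antisym flip: pA)
  then have "size A = card (set_mset A)"
    by (simp add: size_multiset_overloaded_eq)
  moreover have "set_mset A = GF q"
    using P0 by (auto simp: GF_def poly_P simp flip: pA)
  ultimately show ?thesis using A(1) deg by (simp add: q_def)
qed

lemma finite_power_fixed:
  assumes "(1::nat) < n"
  shows "finite {x :: 'a::field. x ^ n = x}" "card {x :: 'a::field. x ^ n = x} \<le> n"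
proof -
  define P :: "'a poly" where "P = monom 1 n - [:0, 1:]"
  have deg: "degree P = n"
    unfolding P_def diff_conv_add_uminus
    by (subst degree_add_eq_left) (use assms in \<open>simp_all add: degree_monom_eq\<close>)
  then have "P \<noteq> 0" using assms by auto
  moreover have "{x. poly P x = 0} = {x. x ^ n = x}" by (simp add: P_def poly_monom)
  ultimately show "finite {x :: 'a. x ^ n = x}" "card {x :: 'a. x ^ n = x} \<le> n"
    using poly_roots_finite[of P] card_poly_roots_bound[of P] deg by auto
qed

text \<open>Multiplication by a nonzero \<open>x\<close> permutes the nonzero elements of
  \<open>F\<close>; comparing their products gives \<open>x ^ (card F - 1) = 1\<close>.\<close>

lemma (in field_subset) power_card_eq:
  assumes "finite F" "x \<in> F"
  shows "x ^ card F = x"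
proof (cases "x = 0")
  case True
  then show ?thesis using assms by (auto simp: power_0_left card_gt_0_iff)
next
  case False
  have "(\<Prod>y\<in>F-{0}. x * y) = \<Prod>(F-{0})"
    by (rule prod.reindex_bij_witness[of _ "\<lambda>y. y / x" "\<lambda>y. x * y"])
       (use False assms mems in auto)
  then have "x ^ card (F - {0}) * \<Prod>(F-{0}) = 1 * \<Prod>(F-{0})"
    by (simp add: prod.distrib)
  moreover have "\<Prod>(F-{0}) \<noteq> 0" using assms(1) by (simp add: prod_zero_iff)
  ultimately have "x ^ card (F - {0}) = 1" by (simp only: mult_cancel_right) simp
  moreover have "card F = Suc (card (F - {0}))"
    using card.remove[OF assms(1) zero_mem] .
  ultimately show ?thesis by simp
qed

text \<open>\<open>B\<close> has the basis 1, \<open>w\<close> over the fixed field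
  \<open>B0\<close> of \<open>\<theta>\<close>, so \<open>card B0\<close> is the wanted
  \<open>p ^ j\<close>. As \<open>w * w\<close> lies in \<open>B0\<close>, its power with exponent
  \<open>card B0\<close> is itself, and only the sign of \<open>w ^ card B0\<close> remains to be
  settled.\<close>

lemma field_involution_power:
  fixes B :: "'a::field set"
  assumes "field_subset B" and p: "prime p" and card: "card B = p ^ e" and two: "(2 :: 'a) \<noteq> 0"
    and \<theta>B: "\<And>x. x \<in> B \<Longrightarrow> \<theta> x \<in> B" and inv: "\<And>x. x \<in> B \<Longrightarrow> \<theta> (\<theta> x) = x"
    and add: "\<And>x y. x \<in> B \<Longrightarrow> y \<in> B \<Longrightarrow> \<theta> (x + y) = \<theta> x + \<theta> y"
    and mult: "\<And>x y. x \<in> B \<Longrightarrow> y \<in> B \<Longrightarrow> \<theta> (x * y) = \<theta> x * \<theta> y"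
    and one: "\<theta> 1 = 1" and w: "w \<in> B" "w \<noteq> 0" "\<theta> w = - w"
  obtains j where "2 * j = e" "w ^ (p ^ j) = - w"
proof -
  interpret B: field_subset B by fact
  have fin: "finite B" using card p by (metis card.infinite power_eq_0_iff not_prime_0)
  define B0 where "B0 = {x \<in> B. \<theta> x = x}"
  have zero: "\<theta> 0 = 0" using add[of 0 0] B.zero_mem by (metis add.right_neutral add_cancel_right_left)
  have minus: "\<theta> (- x) = - \<theta> x" if "x \<in> B" for x
    using add[OF that B.minus_mem[OF that]] zero by (simp add: eq_neg_iff_add_eq_0 add.commute)
  interpret B0: field_subset B0
  proof
    fix x y assume x: "x \<in> B0" and y: "y \<in> B0"
    show "x - y \<in> B0"
      using x y add[of x "- y"] by (simp add: B0_def B.mems minus)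
    show "x * y \<in> B0" using x y by (simp add: B0_def B.mems mult)
  next
    fix x assume x: "x \<in> B0"
    show "inverse x \<in> B0"
    proof (cases "x = 0")
      case False
      then have "x * \<theta> (inverse x) = 1"
        using x mult[of x "inverse x"] by (simp add: B0_def B.mems one)
      then have "\<theta> (inverse x) = inverse x" by (rule inverse_unique[symmetric])
      then show ?thesis using x by (simp add: B0_def B.mems)
    qed (use x in simp)
  qed (simp add: B0_def B.mems one)
  have B0B: "B0 \<subseteq> B" by (auto simp: B0_def)
  then have fin0: "finite B0" using fin finite_subset by blast
  \<comment> \<open>\<open>B\<close> splits into the eigenspaces of \<open>\<theta>\<close> for \<open>1\<close> and \<open>- 1\<close>, and the latter is \<open>w B0\<close>.\<close>
  have "bij_betw (\<lambda>(x, y). x + y * w) (B0 \<times> B0) B"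
  proof (rule bij_betwI[where g = "\<lambda>x. ((x + \<theta> x) / 2, (x - \<theta> x) / (2 * w))"])
    show "(\<lambda>(x, y). x + y * w) \<in> B0 \<times> B0 \<rightarrow> B"
      using B0B w by (auto intro!: B.mems)
    have t2: "\<theta> 2 = 2" using add[of 1 1] B.one_mem one by simp
    have half: "x / 2 \<in> B0" if "x \<in> B0" for x using B0.divide_mem[OF that B0.two_mem] .
    show "(\<lambda>x. ((x + \<theta> x) / 2, (x - \<theta> x) / (2 * w))) \<in> B \<rightarrow> B0 \<times> B0"
    proof (clarsimp, intro conjI)
      fix x assume x: "x \<in> B"
      show "(x + \<theta> x) / 2 \<in> B0"
        by (rule half) (use x in \<open>simp add: B0_def B.mems \<theta>B add inv add.commute\<close>)
      have iw: "\<theta> (inverse w) = - inverse w"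
      proof -
        have "- w * \<theta> (inverse w) = 1"
          using w mult[of w "inverse w"] by (simp add: B.mems one)
        then show ?thesis using inverse_unique by fastforce
      qed
      have diff: "\<theta> (x - \<theta> x) = - (x - \<theta> x)"
        using x add[of x "- \<theta> x"] by (simp add: B.mems \<theta>B minus inv)
      have "\<theta> ((x - \<theta> x) * inverse w) = \<theta> (x - \<theta> x) * \<theta> (inverse w)"
        using x w by (intro mult B.mems \<theta>B)
      also have "\<dots> = (x - \<theta> x) * inverse w" unfolding diff iw by (rule minus_mult_minus)
      finally have "(x - \<theta> x) / w \<in> B0"
        using x w by (simp add: B0_def B.mems \<theta>B divide_inverse)
      from half[OF this] show "(x - \<theta> x) / (2 * w) \<in> B0" by (simp add: mult.commute)
    qed
    show "(case ((x + \<theta> x) / 2, (x - \<theta> x) / (2 * w)) of (x, y) \<Rightarrow> x + y * w) = x" for x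
    proof -
      have "(x + \<theta> x) / 2 + (x - \<theta> x) / (2 * w) * w = ((x + \<theta> x) + (x - \<theta> x)) / 2"
        using w(2) by (subst add_divide_distrib) simp
      then show ?thesis using two by simp
    qed
    show "(\<lambda>z. ((z + \<theta> z) / 2, (z - \<theta> z) / (2 * w))) (case xy of (x, y) \<Rightarrow> x + y * w) = xy"
      if "xy \<in> B0 \<times> B0" for xy
    proof -
      define z where "z = (case xy of (x, y) \<Rightarrow> x + y * w)"
      obtain x y where xy: "xy = (x, y)" "x \<in> B" "y \<in> B" "\<theta> x = x" "\<theta> y = y"
        using \<open>xy \<in> _\<close> by (auto simp: B0_def)
      have "\<theta> z = x - y * w" using xy w by (simp add: z_def add mult B.mems)
      then have "((z + \<theta> z) / 2, (z - \<theta> z) / (2 * w)) = xy"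
        using two w(2) by (simp add: z_def xy(1) mult.commute flip: mult_2)
      then show ?thesis by (simp add: z_def)
    qed
  qed
  then have "card B0 * card B0 = p ^ e"
    using bij_betw_same_card card card_cartesian_product by metis
  moreover from this have "card B0 dvd p ^ e" by (metis dvd_triv_left)
  then obtain j where j: "card B0 = p ^ j"
    using p by (auto simp: divides_primepow_nat)
  ultimately have "p ^ (2 * j) = p ^ e" by (simp add: power_add mult_2)
  then have e: "2 * j = e" using prime_gt_1_nat[OF p] power_inject_exp by blast
  have "w * w \<in> B0" using w by (simp add: B0_def B.mems mult)
  then have "(w * w) ^ card B0 = w * w" by (rule B0.power_card_eq[OF fin0])
  then have "w ^ card B0 * w ^ card B0 = w * w" by (simp add: power_mult_distrib)
  then have "w ^ card B0 = w \<or> w ^ card B0 = - w" by (rule square_eq_iff[THEN iffD1])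
  \<comment> \<open>Otherwise \<open>w\<close> and the elements of \<open>B0\<close> would be too
    many roots of X^r - X, where r is \<open>card B0\<close>.\<close>
  moreover have "w ^ card B0 \<noteq> w"
  proof
    assume ww: "w ^ card B0 = w"
    have "w \<notin> B0"
    proof
      assume "w \<in> B0"
      then have "w = - w" using w by (simp add: B0_def)
      then have "2 * w = 0" by (metis add.right_inverse mult_2)
      then show False using two w by simp
    qed
    have "1 < card B0"
      using card_mono[OF fin0, of "{0, 1}"] B0.mems by simp
    have "insert w B0 \<subseteq> {x. x ^ card B0 = x}" using ww B0.power_card_eq[OF fin0] by auto
    then have "card (insert w B0) \<le> card B0"
      using finite_power_fixed[OF \<open>1 < card B0\<close>, where 'a='a] card_mono le_trans by blast
    then show False using \<open>w \<notin> B0\<close> fin0 by simp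
  qed
  ultimately show ?thesis using that e j by auto
qed

section \<open>Realising \<open>PSL(2, F)\<close> and \<open>PGL(2, F)\<close> inside \<open>PGL(2, K)\<close>\<close>

text \<open>The adjugate divided by the determinant has entries in \<open>F\<close>. The relation
  between the determinants keeps inverses within SL(2, F) too.\<close>

lemma (in field_subset) GL2_inverse:
  assumes "A \<in> carrier (GL2 F)"
  obtains B where "B \<in> carrier (GL2 F)" "B ** A = mat 1" "det B * det A = 1"
proof -
  define D where "D = det A"
  define B :: "'a^2^2" where
    "B = vector [vector [A $ 2 $ 2 / D, - A $ 1 $ 2 / D], vector [- A $ 2 $ 1 / D, A $ 1 $ 1 / D]]"
  have A: "A $ i $ j \<in> F" for i j using assms by (simp add: GL2_def)
  have D0: "D \<noteq> 0" using assms by (simp add: GL2_def D_def)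
  have D: "D = A $ 1 $ 1 * A $ 2 $ 2 - A $ 1 $ 2 * A $ 2 $ 1" by (simp add: D_def det_2)
  have "D \<in> F" unfolding D using A by (simp add: mems)
  have BA: "B ** A = mat 1"
  proof -
    have "A $ 1 $ 1 * A $ 2 $ 2 / D - A $ 1 $ 2 * A $ 2 $ 1 / D = 1"
      using D0 by (simp add: D[symmetric] flip: diff_divide_distrib)
    then show ?thesis
      by (simp add: B_def vec_eq_iff forall_2 matrix_matrix_mult_def sum_2 vector_2 mat_def mult_ac)
  qed
  then have det: "det B * det A = 1" by (metis det_I det_mul)
  then have "det B \<noteq> 0" by auto
  moreover have "\<forall>i j. B $ i $ j \<in> F"
    using A \<open>D \<in> F\<close> by (simp add: B_def forall_2 vector_2 mems)
  ultimately show ?thesis using that BA det by (simp add: GL2_def)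
qed

lemma (in field_subset) GL2_mult:
  assumes "A \<in> carrier (GL2 F)" "B \<in> carrier (GL2 F)"
  shows "A ** B \<in> carrier (GL2 F)"
proof -
  have "(A ** B) $ i $ j \<in> F" for i j
    using assms by (simp add: GL2_def matrix_matrix_mult_def sum_2 mems)
  then show ?thesis using assms by (simp add: GL2_def det_mul)
qed

lemma (in field_subset) mat_1_mem: "(mat 1 :: 'a^2^2) $ i $ j \<in> F"
  by (simp add: mat_def mems)

lemma (in field_subset) group_GL2_sub: "group (GL2 F)"
proof (rule groupI)
  show "\<exists>B\<in>carrier (GL2 F). B \<otimes>\<^bsub>GL2 F\<^esub> A = \<one>\<^bsub>GL2 F\<^esub>" if "A \<in> carrier (GL2 F)" for A
    by (rule GL2_inverse[OF that]) (auto simp: GL2_def)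
  show "A \<otimes>\<^bsub>GL2 F\<^esub> B \<in> carrier (GL2 F)" if "A \<in> carrier (GL2 F)" "B \<in> carrier (GL2 F)" for A B
    using GL2_mult[OF that] by (simp add: GL2_def)
qed (auto simp: GL2_def matrix_mul_assoc mat_1_mem)

lemma (in field_subset) group_SL2: "group (SL2 F)"
proof (rule groupI)
  show "\<exists>B\<in>carrier (SL2 F). B \<otimes>\<^bsub>SL2 F\<^esub> A = \<one>\<^bsub>SL2 F\<^esub>" if "A \<in> carrier (SL2 F)" for A
  proof -
    have "A \<in> carrier (GL2 F)" using that by (simp add: SL2_def)
    then obtain B where "B \<in> carrier (GL2 F)" "B ** A = mat 1" "det B * det A = 1"
      by (rule GL2_inverse)
    then show ?thesis using that by (intro bexI[of _ B]) (auto simp: SL2_def GL2_def)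
  qed
  show "A \<otimes>\<^bsub>SL2 F\<^esub> B \<in> carrier (SL2 F)" if "A \<in> carrier (SL2 F)" "B \<in> carrier (SL2 F)" for A B
    using GL2_mult[of A B] that by (auto simp: GL2_def SL2_def det_mul)
qed (auto simp: GL2_def SL2_def matrix_mul_assoc mat_1_mem)

lemma proj_class_eq_one_iff_mat:
  fixes A :: "'a::field^2^2"
  assumes "det A \<noteq> 0"
  shows "proj_class A = \<one>\<^bsub>PGL2 UNIV\<^esub> \<longleftrightarrow> (\<exists>c. A = mat c)"
  by (subst proj_class_eq_one[OF assms]) (auto simp: vec_eq_iff forall_2 mat_def)

text \<open>The first isomorphism theorem for \<open>proj_class\<close> on \<open>S\<close>: its
  kernel consists of the scalar matrices in \<open>S\<close>. This turns the abstract quotients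
  \<open>PSL2 F\<close> and \<open>PGL2 F\<close> into subgroups of PGL(2, K).\<close>

lemma quotient_mult_iso:
  fixes S :: "('a::field^2^2) monoid"
  assumes S: "group S" and mult: "mult S = (**)" and det: "\<And>A. A \<in> carrier S \<Longrightarrow> det A \<noteq> 0"
    and N: "N = {A \<in> carrier S. \<exists>c. A = mat c}" and iso: "K \<cong> S Mod N"
    and K: "mult K = mult (PGL2 (UNIV :: 'a set))"
  obtains \<psi> where "mult_iso \<psi> (carrier K) (proj_class ` carrier S)"
proof -
  interpret S: group S by fact
  interpret h: group_hom S "PGL2 (UNIV :: 'a set)" proj_class
    by unfold_locales (auto simp: hom_def mult det proj_class_mult intro!: proj_class_carrier)
  define T where "T = PGL2 (UNIV :: 'a set)\<lparr>carrier := proj_class ` carrier S\<rparr>"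
  have "group T"
    unfolding T_def by (rule PGL.subgroup_imp_group[OF h.img_is_subgroup])
  then interpret T: group_hom S T proj_class
    by (intro group_hom.intro group_hom_axioms.intro S)
       (auto simp: hom_def T_def mult det proj_class_mult)
  have "kernel S T proj_class = N"
    unfolding kernel_def N T_def
    using det proj_class_eq_one_iff_mat by auto
  then have "S Mod N \<cong> T"
    using T.FactGroup_iso by (simp add: T_def)
  then have "K \<cong> T" using iso iso_trans by blast
  then obtain \<psi> where "\<psi> \<in> iso K T" by (auto simp: is_iso_def)
  then show ?thesis
    by (intro that[of \<psi>]) (auto simp: mult_iso_def iso_def hom_def T_def K)
qed

text \<open>\<open>H\<close> is the image of SL(2, F) or GL(2, F). Conjugation over \<open>F\<close>
  keeps determinants, so it preserves \<open>H\<close> in both cases, and the listed elements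
  already come from SL(2, F).\<close>

lemma (in field_subset) projective_iso:
  assumes K: "mult K = mult (PGL2 (UNIV :: 'a set))" and iso: "K \<cong> PSL2 F \<or> K \<cong> PGL2 F"
  obtains \<psi> H where "mult_iso \<psi> (carrier K) H" "H \<subseteq> pgl_points F"
    "\<And>q x. q \<in> pgl_points F \<Longrightarrow> x \<in> H \<Longrightarrow> q \<star> x \<star> inv\<^bsub>PGL2 UNIV\<^esub> q \<in> H"
    "\<And>b. b \<in> F \<Longrightarrow> uni b \<in> H" "\<And>a. a \<in> F \<Longrightarrow> a \<noteq> 0 \<Longrightarrow> dia (a\<^sup>2) \<in> H"
proof -
  have pts: "pgl_points F = proj_class ` carrier (GL2 F)"
  proof
    show "pgl_points F \<subseteq> proj_class ` carrier (GL2 F)"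
      unfolding pgl_points_def mob_def
      by (auto intro!: imageI simp: GL2_def forall_2 vector_2 det_2)
    show "proj_class ` carrier (GL2 F) \<subseteq> pgl_points F"
      by (auto simp: GL2_def det_2 proj_class_eq_mob intro!: pgl_pointsI)
  qed
  define M where "M = carrier (if K \<cong> PSL2 F then SL2 F else GL2 F)"
  have scal: "scalars2 F \<inter> carrier (SL2 F) = {A \<in> carrier (SL2 F). \<exists>c. A = mat c}"
    "scalars2 F = {A \<in> carrier (GL2 F). \<exists>c. A = mat c}"
    by (auto simp: scalars2_def SL2_def GL2_def forall_2 mat_def det_2 zero_mem)
  obtain \<psi> where \<psi>: "mult_iso \<psi> (carrier K) (proj_class ` M)"
  proof (cases "K \<cong> PSL2 F")
    case True
    show ?thesis
      by (rule quotient_mult_iso[OF group_SL2 _ _ scal(1) _ K])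
         (use True that in \<open>auto simp: M_def SL2_def GL2_def PSL2_def\<close>)
  next
    case False
    show ?thesis
      by (rule quotient_mult_iso[OF group_GL2_sub _ _ scal(2) _ K])
         (use False iso that in \<open>auto simp: M_def GL2_def PGL2_def\<close>)
  qed
  have M: "carrier (SL2 F) \<subseteq> M" "M \<subseteq> carrier (GL2 F)"
    by (auto simp: M_def SL2_def)
  show ?thesis
  proof (rule that[OF \<psi>])
    show "proj_class ` M \<subseteq> pgl_points F" using M pts by auto
    show "q \<star> x \<star> inv\<^bsub>PGL2 UNIV\<^esub> q \<in> proj_class ` M"
      if q: "q \<in> pgl_points F" and x: "x \<in> proj_class ` M" for q x
    proof -
      obtain Q where Q: "Q \<in> carrier (GL2 F)" "q = proj_class Q" using q pts by auto
      obtain A where A: "A \<in> M" "x = proj_class A" using x by auto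
      obtain R where R: "R \<in> carrier (GL2 F)" "R ** Q = mat 1" "det R * det Q = 1"
        using Q(1) by (rule GL2_inverse)
      have det: "det Q \<noteq> 0" "det R \<noteq> 0" "det A \<noteq> 0"
        using R(3) A(1) M by (auto simp: GL2_def)
      have "inv\<^bsub>PGL2 UNIV\<^esub> q = proj_class R"
        unfolding Q(2) using det
        by (intro PGL.inv_equality proj_class_carrier)
           (auto simp: proj_class_mult R proj_class_eq_one_iff_mat)
      then have eq: "q \<star> x \<star> inv\<^bsub>PGL2 UNIV\<^esub> q = proj_class (Q ** A ** R)"
        using det by (simp add: Q A proj_class_mult det_mul)
      have "det (Q ** A ** R) = det A" using R(3) by (simp add: det_mul mult_ac)
      moreover have "Q ** A ** R \<in> carrier (GL2 F)"
        using Q A R M by (intro GL2_mult) auto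
      ultimately have "Q ** A ** R \<in> M"
        using A by (auto simp: M_def SL2_def split: if_splits)
      then show ?thesis unfolding eq by blast
    qed
    have sl: "mob a b c d \<in> proj_class ` M"
      if "a \<in> F" "b \<in> F" "c \<in> F" "d \<in> F" "a * d - b * c = 1" for a b c d
    proof -
      have "a * d \<noteq> b * c" using that(5) by auto
      then show ?thesis
        unfolding mob_def using that
        by (intro imageI subsetD[OF M(1)]) (simp add: SL2_def GL2_def forall_2 vector_2 det_2)
    qed
    show "uni b \<in> proj_class ` M" if "b \<in> F" for b
      by (rule sl) (use that in \<open>auto simp: mems\<close>)
    show "dia (a\<^sup>2) \<in> proj_class ` M" if "a \<in> F" "a \<noteq> 0" for a
    proof -
      \<comment> \<open>Squares arise by rescaling the diagonal matrix with entries \<open>a\<close>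
        and \<open>inverse a\<close>, of determinant 1.\<close>
      have "dia (a\<^sup>2) = mob a 0 0 (inverse a)"
        using that by (intro mob_eqI[of a]) (simp_all add: power2_eq_square)
      also have "\<dots> \<in> proj_class ` M" by (rule sl) (use that in \<open>auto simp: mems\<close>)
      finally show ?thesis .
    qed
  qed
qed

section \<open>The Petrie dual\<close>

definition power_map :: "nat \<Rightarrow> ('a::field^2^2) set \<Rightarrow> ('a^2^2) set" where
  "power_map r C = (\<lambda>A. \<chi> i j. (A $ i $ j) ^ r) ` C"

text \<open>Over an algebraically closed field every nonzero scalar is an r-th power of a nonzero
  scalar, so the image of a class is a whole class and not just a part of one.\<close>

lemma power_map_mob:
  fixes a b c d :: "'a::alg_closed_field"
  assumes "r > 0"
  shows "power_map r (mob a b c d) = mob (a ^ r) (b ^ r) (c ^ r) (d ^ r)"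
proof -
  define f :: "'a^2^2 \<Rightarrow> 'a^2^2" where "f = (\<lambda>A. \<chi> i j. (A $ i $ j) ^ r)"
  define A :: "'a^2^2" where "A = vector [vector [a, b], vector [c, d]]"
  have f: "f (mat k ** A) = mat (k ^ r) ** f A" for k
    by (simp add: f_def vec_eq_iff forall_2 matrix_matrix_mult_def sum_2 mat_def power_mult_distrib)
  have fA: "vector [vector [a ^ r, b ^ r], vector [c ^ r, d ^ r]] = f A"
    by (simp add: f_def A_def vec_eq_iff forall_2 vector_2)
  have root: "\<exists>l. l ^ r = k \<and> l \<noteq> 0" if "k \<noteq> 0" for k :: 'a
    using nth_root_exists[OF assms, of k] that assms by (metis zero_power)
  have "f ` proj_class A = proj_class (f A)"
  proof
    show "f ` proj_class A \<subseteq> proj_class (f A)"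
      unfolding proj_class_altdef using assms by (auto simp: f)
    show "proj_class (f A) \<subseteq> f ` proj_class A"
    proof
      fix C assume "C \<in> proj_class (f A)"
      then obtain k where k: "k \<noteq> 0" "C = mat k ** f A" unfolding proj_class_altdef by blast
      obtain l where "l ^ r = k" "l \<noteq> 0" using root[OF k(1)] by blast
      then have "C = f (mat l ** A)" "mat l ** A \<in> proj_class A"
        using k(2) by (auto simp: f proj_class_altdef)
      then show "C \<in> f ` proj_class A" by blast
    qed
  qed
  then show ?thesis
    unfolding power_map_def mob_def f_def[symmetric] fA A_def[symmetric] .
qed

lemma power_map_hom:
  assumes "prime p" "CHAR('a::alg_closed_field) = p"
  shows "power_map (p ^ n) \<in> hom (PGL2 (UNIV :: 'a set)) (PGL2 UNIV)"
proof -
  define r where "r = p ^ n"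
  have r: "r > 0" using assms by (simp add: r_def prime_gt_0_nat)
  have diff: "(x - y) ^ r = x ^ r - y ^ r" for x y :: 'a
    unfolding r_def by (rule power_diff_char[OF assms])
  have add: "(x + y) ^ r = x ^ r + y ^ r" for x y :: 'a
    using assms by (intro freshmans_dream') (auto simp: r_def)
  have det: "a ^ r * d ^ r - b ^ r * c ^ r \<noteq> 0" if "a * d - b * c \<noteq> 0" for a b c d :: 'a
    using that r by (simp add: diff flip: power_mult_distrib)
       (metis diff eq_iff_diff_eq_0 power_eq_0_iff)
  show ?thesis
  proof (rule homI, fold r_def)
    fix x :: "('a^2^2) set" assume x: "x \<in> carrier (PGL2 UNIV)"
    show "power_map r x \<in> carrier (PGL2 UNIV)"
      using x by (rule pgl_cases) (use r det in \<open>auto simp: power_map_mob intro!: mob_carrier\<close>)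
  next
    fix x y :: "('a^2^2) set" assume x: "x \<in> carrier (PGL2 UNIV)" and y: "y \<in> carrier (PGL2 UNIV)"
    obtain a b c d where x: "x = mob a b c d" "a * d - b * c \<noteq> 0" using x by (rule pgl_cases)
    obtain a' b' c' d' where y: "y = mob a' b' c' d'" "a' * d' - b' * c' \<noteq> 0" using y by (rule pgl_cases)
    show "power_map r (x \<star> y) = power_map r x \<star> power_map r y"
      unfolding x(1) y(1) mob_mult[OF x(2) y(2)] power_map_mob[OF r]
        mob_mult[OF det[OF x(2)] det[OF y(2)]]
      by (simp add: add power_mult_distrib)
  qed
qed

text \<open>An endomorphism of the ambient group suffices: \<open>f\<close> maps generators into the
  subgroup and \<open>f\<close> applied twice fixes them, so \<open>f\<close> restricts to an
  involution. That \<open>y\<close> squares to the identity gives the value at the product of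
  \<open>x\<close> and \<open>y\<close>.\<close>

lemma self_petrie_dualI:
  assumes "group P" and xyz: "{x, y, z} \<subseteq> carrier P" and f: "f \<in> hom P P"
    and yy: "y \<otimes>\<^bsub>P\<^esub> y = \<one>\<^bsub>P\<^esub>" and fy: "f y = y" and fz: "f z = z" and fx: "f x = x \<otimes>\<^bsub>P\<^esub> y"
  shows "self_petrie_dual (subgroup_generated P {x, y, z}) x y z"
proof -
  interpret P: group P by fact
  interpret f: group_hom P P f
    using f by unfold_locales
  define G where "G = generate P {x, y, z}"
  have carrier: "carrier (subgroup_generated P {x, y, z}) = G"
    using xyz by (simp add: carrier_subgroup_generated G_def Int_absorb1)
  have Gsub: "G \<subseteq> carrier P" unfolding G_def by (rule P.generate_incl[OF xyz])
  have xG: "x \<in> G" "y \<in> G" "z \<in> G" by (auto simp: G_def intro: generate.incl)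
  have mult: "a \<otimes>\<^bsub>P\<^esub> b \<in> G" if "a \<in> G" "b \<in> G" for a b
    using that by (auto simp: G_def intro: generate.eng)
  have inv: "inv\<^bsub>P\<^esub> a \<in> G" if "a \<in> G" for a
    using that xyz by (auto simp: G_def intro: P.generate_m_inv_closed)
  have fxy: "f (x \<otimes>\<^bsub>P\<^esub> y) = x"
    using xyz yy by (simp add: fx fy P.m_assoc)
  have gen: "f a \<in> G \<and> f (f a) = a" if "a \<in> {x, y, z}" for a
    using that xG mult[OF xG(1,2)] by (auto simp: fx fy fz fxy)
  have "f a \<in> G \<and> f (f a) = a" if "a \<in> G" for a
    using that unfolding G_def
  proof (induction rule: generate.induct)
    case one
    show ?case by (simp add: generate.one)
  next
    case (incl h)
    then show ?case using gen by (simp add: G_def)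
  next
    case (inv h)
    then have h: "h \<in> carrier P" "f h \<in> G" "f (f h) = h" using xyz gen by auto
    then show ?case using \<open>\<And>a. a \<in> G \<Longrightarrow> inv\<^bsub>P\<^esub> a \<in> G\<close> by (simp flip: G_def)
  next
    case (eng h1 h2)
    then have "h1 \<in> carrier P" "h2 \<in> carrier P" using Gsub by (auto simp: G_def)
    with eng show ?case using mult by (simp add: G_def)
  qed
  note fG = this[THEN conjunct1] this[THEN conjunct2]
  have "bij_betw f G G"
    by (rule bij_betwI[where g = f]) (use fG in auto)
  then have "f \<in> iso (subgroup_generated P {x, y, z}) (subgroup_generated P {x, y, z})"
    using fG Gsub by (auto simp: iso_def hom_def carrier subset_iff)
  then show ?thesis
    unfolding self_petrie_dual_def
    using fG fx fy fz fxy by (intro bexI[of _ f]) (auto simp: carrier)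
qed

text \<open>Rescaling removes \<open>\<alpha>\<close> and leaves \<open>\<omega>\<^sup>2\<close> as
  the only parameter of the triple.\<close>

lemma gen_eq_mob:
  assumes "\<alpha> \<noteq> 0" "\<omega> \<noteq> 0"
  shows "gen_X \<alpha> \<omega> = anti (\<omega>\<^sup>2)" "gen_Y \<alpha> = dia (- 1)" "gen_Z \<alpha> = mob 1 1 0 (- 1)"
proof -
  have "gen_X \<alpha> \<omega> = mob 0 (\<alpha> * inverse \<omega>) (\<alpha> * \<omega>) 0"
    by (simp add: gen_X_def proj_class_eq_mob mat2_simps)
  then show "gen_X \<alpha> \<omega> = anti (\<omega>\<^sup>2)"
    using assms by (simp add: power2_eq_square) (rule mob_eqI[of "\<alpha> * inverse \<omega>"]; simp)
  have "gen_Y \<alpha> = mob (- \<alpha>) 0 0 \<alpha>"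
    by (simp add: gen_Y_def proj_class_eq_mob mat2_simps)
  then show "gen_Y \<alpha> = dia (- 1)"
    using assms by simp (rule mob_eqI[of \<alpha>]; simp)
  have "gen_Z \<alpha> = mob \<alpha> \<alpha> 0 (- \<alpha>)"
    by (simp add: gen_Z_def proj_class_eq_mob mat2_simps)
  then show "gen_Z \<alpha> = mob 1 1 0 (- 1)"
    using assms by simp (rule mob_eqI[of \<alpha>]; simp)
qed

text \<open>Two uses of \<open>fixed_iso_field_map\<close>: for the normalised isomorphism
  \<open>\<phi>\<close> it yields a field \<open>B\<close> of order \<open>p ^ e\<close> inside the
  group, for \<open>\<sigma>\<close> an involution \<open>\<theta>\<close> of
  \<open>B\<close>.\<close>

lemma self_petrie_dual_imp_involution:
  fixes w :: "'a::alg_closed_field" and e :: nat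
  assumes two: "(2 :: 'a) \<noteq> 0" and p: "prime p" "CHAR('a) = p" and e: "e > 0" and w: "w \<noteq> 0"
    and K: "K = subgroup_generated (PGL2 UNIV) {anti w, dia (- 1), mob 1 1 0 (- 1)}"
    and iso: "K \<cong> PSL2 (GF (p ^ e) :: 'a set) \<or> K \<cong> PGL2 (GF (p ^ e) :: 'a set)"
    and dual: "self_petrie_dual K (anti w) (dia (- 1)) (mob 1 1 0 (- 1))"
  obtains j where "2 * j = e" "w ^ (p ^ j) = - w"
proof -
  define F :: "'a set" where "F = GF (p ^ e)"
  have sub: "field_subset F" unfolding F_def by (rule field_subset_GF[OF p])
  interpret F: field_subset F by (fact sub)
  define G where "G = carrier K"
  have multK: "mult K = mult (PGL2 UNIV)" by (simp add: K)
  have G: "subgroup G (PGL2 UNIV)"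
    unfolding G_def K by (rule PGL.subgroup_subgroup_generated)
  interpret G: subgroup G "PGL2 UNIV" by (fact G)
  have "{anti w, dia (- 1), mob 1 1 0 (- 1)} \<subseteq> G"
    unfolding G_def K
    by (rule PGL.subgroup_generated_subset_carrier_subset) (use w in \<open>auto intro!: mob_carrier\<close>)
  then have gens: "anti w \<in> G" "dia (- 1) \<in> G" "mob 1 1 0 (- 1) \<in> G" by auto
  have yz: "dia (- 1) \<star> mob 1 1 0 (- 1) = uni (1 :: 'a)"
    by (simp add: mob_mult) (rule mob_eqI[of "- 1"]; simp)
  have u: "uni 1 \<in> G" using G.m_closed[OF gens(2,3)] by (simp add: yz)
  have xy: "anti w \<star> dia (- 1) = anti (- w)"
    using w by (simp add: mob_mult)
  obtain \<psi> H where \<psi>: "mult_iso \<psi> G H" and H: "H \<subseteq> pgl_points F"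
    "\<And>q x. q \<in> pgl_points F \<Longrightarrow> x \<in> H \<Longrightarrow> q \<star> x \<star> inv\<^bsub>PGL2 UNIV\<^esub> q \<in> H"
    "\<And>b. b \<in> F \<Longrightarrow> uni b \<in> H" "\<And>a. a \<in> F \<Longrightarrow> a \<noteq> 0 \<Longrightarrow> dia (a\<^sup>2) \<in> H"
    using F.projective_iso[OF multK iso[folded F_def], folded G_def] by blast
  obtain \<phi> d where \<phi>: "mult_iso \<phi> G H" "\<phi> (uni 1) = uni 1" "\<phi> (dia (- 1)) = dia (- 1)"
    "\<phi> (anti w) = anti d" and d: "d \<in> F" "d \<noteq> 0"
    by (rule normalized_iso_exists[OF sub two p G \<psi> H(1,2) u gens(2,1) w])
  obtain g where g: "\<And>b. b \<in> F \<Longrightarrow> uni (g b) \<in> G" "\<And>b. b \<in> F \<Longrightarrow> \<phi> (uni (g b)) = uni b"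
    "\<And>a b. a \<in> F \<Longrightarrow> b \<in> F \<Longrightarrow> g (a + b) = g a + g b"
    "\<And>a b. a \<in> F \<Longrightarrow> b \<in> F \<Longrightarrow> g (a * b) = g a * g b"
    "g 1 = 1" "g d = w" "\<And>a. a \<in> F \<Longrightarrow> a \<noteq> 0 \<Longrightarrow> dia ((g a)\<^sup>2) \<in> G"
    using fixed_iso_field_map[OF two sub G \<phi>(1) u gens(2,1) \<phi>(2-4) H(3,4) d w] by blast
  define B where "B = g ` F"
  have inj\<phi>: "x = y" if "\<phi> x = \<phi> y" "x \<in> G" "y \<in> G" for x y
    using \<phi>(1) that by (auto simp: mult_iso_def bij_betw_def dest: inj_onD)
  have g0: "g 0 = 0" using g(3)[of 0 0] F.zero_mem by (metis add.right_neutral add_cancel_right_left)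
  have g_minus: "g (- a) = - g a" if "a \<in> F" for a
    using g(3)[OF that F.minus_mem[OF that]] g0 by (simp add: eq_neg_iff_add_eq_0 add.commute)
  have inj: "inj_on g F" by (rule inj_onI) (metis g(2) uni_eq_iff)
  have "card B = card F" unfolding B_def by (rule card_image[OF inj])
  then have cardB: "card B = p ^ e" using card_GF[OF p e] by (simp add: F_def)
  have subB: "field_subset B"
  proof
    show "1 \<in> B" unfolding B_def using g(5) F.one_mem by (metis imageI)
    fix x y assume "x \<in> B" "y \<in> B"
    then obtain a b where ab: "a \<in> F" "x = g a" "b \<in> F" "y = g b" unfolding B_def by auto
    have "x - y = g (a + - b)" using ab by (simp only: g F.mems g_minus) simp
    then show "x - y \<in> B" unfolding B_def using ab by (blast intro: F.mems)
    have "x * y = g (a * b)" using ab by (simp add: g)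
    then show "x * y \<in> B" unfolding B_def using ab by (blast intro: F.mems)
  next
    fix x assume "x \<in> B"
    then obtain a where a: "a \<in> F" "x = g a" unfolding B_def by auto
    show "inverse x \<in> B"
    proof (cases "a = 0")
      case True
      then show ?thesis using a g0 \<open>x \<in> B\<close> by simp
    next
      case False
      then have "g a * g (inverse a) = 1" using g(4)[of a "inverse a"] a g(5) by (simp add: F.mems)
      then have "inverse x = g (inverse a)" unfolding a(2) by (rule inverse_unique)
      then show ?thesis unfolding B_def using a by (blast intro: F.mems)
    qed
  qed
  interpret B: field_subset B by (fact subB)
  have wB: "w \<in> B" unfolding B_def using g(6) d by blast
  \<comment> \<open>Every translation in \<open>G\<close> is reached: its image centralises
    \<open>u\<close>, hence is \<open>uni c\<close> with \<open>c\<close> in \<open>F\<close>. This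
    makes \<open>\<theta>\<close> map \<open>B\<close> into itself.\<close>
  have B_uni: "b \<in> B \<longleftrightarrow> uni b \<in> G" for b
  proof
    assume b: "uni b \<in> G"
    have im: "\<phi> (uni b) \<in> H" using \<phi>(1) b by (auto simp: mult_iso_def bij_betw_def)
    have "\<phi> (uni b \<star> uni 1) = \<phi> (uni 1 \<star> uni b)" by (simp add: uni_mult add.commute)
    then have "\<phi> (uni b) \<star> uni 1 = uni 1 \<star> \<phi> (uni b)"
      using \<phi>(1,2) b u by (simp add: mult_iso_def)
    then obtain c where c: "\<phi> (uni b) = uni c"
      using im H(1) pgl_points_subset by (meson commute_uni subsetD)
    then have "c \<in> F" using im H(1) F.pgl_points_last(2)[of 1 c 0] by auto
    then have "uni b = uni (g c)"
      using inj\<phi>[OF _ b g(1)] g(2) c by simp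
    then show "b \<in> B" using \<open>c \<in> F\<close> by (simp add: B_def)
  qed (auto simp: B_def g)
  obtain \<sigma> where \<sigma>: "\<sigma> \<in> iso K K" "\<And>x. x \<in> G \<Longrightarrow> \<sigma> (\<sigma> x) = x"
    "\<sigma> (dia (- 1)) = dia (- 1)" "\<sigma> (mob 1 1 0 (- 1)) = mob 1 1 0 (- 1)" "\<sigma> (anti w) = anti (- w)"
    using dual unfolding self_petrie_dual_def by (auto simp: multK xy G_def)
  have \<sigma>iso: "mult_iso \<sigma> G G"
    using \<sigma>(1) by (auto simp: mult_iso_def iso_def hom_def G_def multK)
  have \<sigma>u: "\<sigma> (uni 1) = uni 1"
    using \<sigma>iso gens \<sigma>(3,4) unfolding yz[symmetric] mult_iso_def by simp
  have diaB: "dia (a\<^sup>2) \<in> G" if "a \<in> B" "a \<noteq> 0" for a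
    using that g(7) g0 by (auto simp: B_def)
  have uni_B: "uni b \<in> G" if "b \<in> B" for b using that B_uni by simp
  have minus_w: "- w \<noteq> 0" using w by simp
  \<comment> \<open>Here \<open>G\<close> is both source and target, \<open>B\<close> replaces
    \<open>F\<close>, and the image of \<open>anti w\<close> has the parameter
    \<open>- w\<close>.\<close>
  obtain \<theta> where \<theta>: "\<And>b. b \<in> B \<Longrightarrow> uni (\<theta> b) \<in> G" "\<And>b. b \<in> B \<Longrightarrow> \<sigma> (uni (\<theta> b)) = uni b"
    "\<And>a b. a \<in> B \<Longrightarrow> b \<in> B \<Longrightarrow> \<theta> (a + b) = \<theta> a + \<theta> b"
    "\<And>a b. a \<in> B \<Longrightarrow> b \<in> B \<Longrightarrow> \<theta> (a * b) = \<theta> a * \<theta> b"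
    "\<theta> 1 = 1" "\<theta> (- w) = w" "\<And>a. a \<in> B \<Longrightarrow> a \<noteq> 0 \<Longrightarrow> dia ((\<theta> a)\<^sup>2) \<in> G"
    using fixed_iso_field_map[OF two subB G \<sigma>iso u gens(2,1) \<sigma>u \<sigma>(3,5) uni_B diaB
        B.minus_mem[OF wB] minus_w w] by blast
  have \<theta>B: "\<theta> b \<in> B" if "b \<in> B" for b using \<theta>(1)[OF that] B_uni by blast
  have inv: "\<theta> (\<theta> b) = b" if "b \<in> B" for b
    using \<theta>(2)[OF \<theta>B[OF that]] \<theta>(2)[OF that] \<sigma>(2)[OF \<theta>(1)[OF \<theta>B[OF that]]]
    by simp
  \<comment> \<open>As \<open>\<theta>\<close> is an involution, \<open>\<theta> (- w) = w\<close>
    turns into \<open>\<theta> w = - w\<close>.\<close>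
  show ?thesis
    by (rule field_involution_power[OF subB p(1) cardB two \<theta>B inv \<theta>(3,4,5) wB w _ that])
       (use inv[OF B.minus_mem[OF wB]] \<theta>(6) in simp_all)
qed

theorem proposition3p5:
  fixes p e q l :: nat
    and \<alpha> \<xi> \<omega> :: "'f::finite_field alg_closure"
  assumes "prime p" and "odd p" and "CARD('f) = p"
    and "e > 0" and "q = p ^ e"
    and "l \<ge> 3" and "coprime l p" and "1 / real p + 1 / real l < 1 / 2"
    and "\<alpha>\<^sup>2 = - 1"
    and "primitive_root_of_unity (2 * l) \<xi>" and "\<xi> \<in> GF q \<or> \<xi> \<in> GF (q\<^sup>2)"
    and "\<omega> = \<xi> + inverse \<xi>"
    and "map_group \<alpha> \<omega> \<cong> PSL2 (GF q :: 'f alg_closure set) \<or>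
         map_group \<alpha> \<omega> \<cong> PGL2 (GF q :: 'f alg_closure set)"
  shows "self_petrie_dual (map_group \<alpha> \<omega>) (gen_X \<alpha> \<omega>) (gen_Y \<alpha>) (gen_Z \<alpha>) \<longleftrightarrow>
         (\<exists>j r :: nat. 2 * j = e \<and> r = p ^ j \<and> \<omega>\<^sup>2 = - (\<omega> ^ (2 * r)))"
proof -
  have char: "CHAR('f alg_closure) = p"
    using CHAR_dvd_CARD[where 'a='f] \<open>CARD('f) = p\<close> \<open>prime p\<close>
    by (metis CHAR_alg_closure CHAR_not_1 One_nat_def prime_nat_iff)
  have two: "(2 :: 'f alg_closure) \<noteq> 0"
  proof
    assume "(2 :: 'f alg_closure) = 0"
    then have "p dvd 2"
      using char of_nat_eq_0_iff_char_dvd[of 2, where 'a="'f alg_closure"] by simp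
    then show False
      using \<open>odd p\<close> \<open>prime p\<close> by (metis primes_dvd_imp_eq two_is_prime_nat dvd_refl)
  qed
  have \<alpha>0: "\<alpha> \<noteq> 0" using \<open>\<alpha>\<^sup>2 = - 1\<close> by auto
  have \<omega>0: "\<omega> \<noteq> 0"
  proof
    assume "\<omega> = 0"
    have "\<xi> \<noteq> 0"
      using \<open>primitive_root_of_unity (2 * l) \<xi>\<close> by (auto simp: primitive_root_of_unity_def power_0_left)
    moreover have "inverse \<xi> = - \<xi>"
      using \<open>\<omega> = 0\<close> \<open>\<omega> = \<xi> + inverse \<xi>\<close> by (simp add: eq_neg_iff_add_eq_0 add.commute)
    ultimately have "\<xi> * \<xi> = - 1" by (metis minus_equation_iff mult_minus_right right_inverse)
    \<comment> \<open>The order of \<open>\<xi>\<close> is \<open>2 * l\<close>, which is at least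
      6.\<close>
    then have "\<xi> ^ 4 = 1" by (simp add: eval_nat_numeral mult.assoc[symmetric])
    then show False
      using \<open>primitive_root_of_unity (2 * l) \<xi>\<close> \<open>l \<ge> 3\<close> by (auto simp: primitive_root_of_unity_def)
  qed
  define w where "w = \<omega>\<^sup>2"
  have w: "w \<noteq> 0" using \<omega>0 by (simp add: w_def)
  have K: "map_group \<alpha> \<omega> = subgroup_generated (PGL2 UNIV) {anti w, dia (- 1), mob 1 1 0 (- 1)}"
    by (simp add: map_group_def gen_eq_mob[OF \<alpha>0 \<omega>0] w_def)
  have power: "\<omega> ^ (2 * r) = w ^ r" for r by (simp add: w_def power_mult)
  show ?thesis
    unfolding gen_eq_mob[OF \<alpha>0 \<omega>0] power w_def[symmetric]
  proof
    assume "self_petrie_dual (map_group \<alpha> \<omega>) (anti w) (dia (- 1)) (mob 1 1 0 (- 1))"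
    then obtain j where "2 * j = e" "w ^ (p ^ j) = - w"
      using self_petrie_dual_imp_involution[OF two \<open>prime p\<close> char \<open>e > 0\<close> w K] assms(13)
      unfolding \<open>q = p ^ e\<close> by blast
    then show "\<exists>j r. 2 * j = e \<and> r = p ^ j \<and> w = - (w ^ r)" by auto
  next
    assume "\<exists>j r. 2 * j = e \<and> r = p ^ j \<and> w = - (w ^ r)"
    then obtain j where j: "w = - (w ^ (p ^ j))" by blast
    \<comment> \<open>Since \<open>p ^ j\<close> is odd, the power map fixes -1 along with 0 and 1,
      hence it fixes \<open>Y\<close> and \<open>Z\<close>.\<close>
    have r: "p ^ j > 0" "odd (p ^ j)" using \<open>prime p\<close> \<open>odd p\<close> by (simp_all add: prime_gt_0_nat)
    have r0: "(0 :: 'f alg_closure) ^ (p ^ j) = 0" using r(1) by (rule zero_power)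
    have wr: "w ^ (p ^ j) = - w" using j by (metis minus_equation_iff)
    show "self_petrie_dual (map_group \<alpha> \<omega>) (anti w) (dia (- 1)) (mob 1 1 0 (- 1))"
      unfolding K
    proof (rule self_petrie_dualI[OF group_PGL2 _ power_map_hom[OF \<open>prime p\<close> char, of j]])
      show "{anti w, dia (- 1), mob 1 1 0 (- 1)} \<subseteq> carrier (PGL2 UNIV)"
        using w by (auto intro!: mob_carrier)
      show "power_map (p ^ j) (anti w) = anti w \<star> dia (- 1)"
        using w r by (simp add: power_map_mob mob_mult wr r0 del: power_eq_0_iff)
    qed (use r in \<open>simp_all add: power_map_mob mob_mult one_eq_mob r0 del: power_eq_0_iff\<close>)
  qed
qed

end
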